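(* The KNS spectral measure $\mu$ of the sequence $\Delta(\Gamma_n)$, i.e. the weak limit as $n\to\infty$ of the spectral counting measures $\nu_n$ of $\Delta(\Gamma_n)$, is $$\mu=\frac23\sum_{k=3}^\infty 2^{-k}\sum_{\{\lambda:\gamma_{k-2}(\lambda)=0\}}\delta_\lambda .$$
   Context: Graphs are finite undirected multigraphs, loops allowed. Each $G_n$ ($n\ge 0$) has two boundary vertices, forming $\partial G_n$. $G_0$: two vertices joined by one edge, both boundary. $G_1$: a path $a-b-c$ with a loop at $b$, $\partial G_1=\{a,c\}$. For $n\ge2$, $G_n$ is obtained from one copy of $G_{n-1}$ and two copies of $G_{n-2}$ by identifying to a single vertex both boundary vertices of $G_{n-1}$ and one boundary vertex of each copy of $G_{n-2}$; the remaining boundary vertex of each copy of $G_{n-2}$ form $\partial G_n$. $\Gamma_0$ is one vertex with two loops; for $n\ge1$, $\Gamma_n$ is obtained from a copy of $G_n$ and a copy of $G_{n-1}$ by identifying all four boundary vertices to a single vertex. $\Gamma_n$ has $2^n$ vertices. Laplacian of a graph $H$: $\Delta(H)f(x)=\sum_y c_{xy}(f(x)-f(y))$, with $c_{xy}$ the number of edges joining $x,y$ (loops contribute $0$). The Dirichlet Laplacian on $G_n$ is the same operator on functions vanishing on $\partial G_n$ (eigenvalue equation imposed at non-boundary vertices), with eigenvalue set $\mathrm{DirSpec}(\Delta(G_n))$. A Dirichlet eigenvalue $\lambda$ is born at level $n$ if $\lambda\in\mathrm{DirSpec}(\Delta(G_n))$ but $\lambda\notin\mathrm{DirSpec}(\Delta(G_m))$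 for $m<n$. $\gamma_n$ ($n\ge1$) is the monic polynomial with simple roots exactly the Dirichlet eigenvalues born at level $n$ on $G_n$. The spectral counting measure of $\Delta(\Gamma_n)$ is $\nu_n=2^{-n}\sum_\lambda\delta_\lambda$, the sum over the $2^n$ eigenvalues of $\Delta(\Gamma_n)$ counted with multiplicity. *)

theory Defs
  imports
    "HOL-Probability.Probability"
    "HOL-Library.Uprod"
    "HOL-Library.Function_Algebras"
    "HOL-Computational_Algebra.Polynomial"
begin

section \<open>Multigraphs and their Laplacians\<close>

text \<open>Edges form a multiset of unordered pairs; a loop at \<open>x\<close> is \<open>Upair x x\<close>.\<close>

record 'v multigraph =
  verts :: "'v set"
  edges :: "'v uprod multiset"

record 'v bgraph = "'v multigraph" +
  ends :: "'v \<times> 'v"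

definition boundary :: "('v, 'z) bgraph_scheme \<Rightarrow> 'v set" where
  "boundary H = {fst (ends H), snd (ends H)}"

definition conductance :: "('v, 'z) multigraph_scheme \<Rightarrow> 'v \<Rightarrow> 'v \<Rightarrow> nat" where
  "conductance H x y = count (edges H) (Upair x y)"

definition laplacian :: "('v, 'z) multigraph_scheme \<Rightarrow> ('v \<Rightarrow> real) \<Rightarrow> 'v \<Rightarrow> real" where
  "laplacian H f x = (\<Sum>y\<in>verts H. real (conductance H x y) * (f x - f y))"

text \<open>A function on the vertex set of \<open>H\<close> is represented by its extension by zero to the whole
  vertex type, so the vanishing conditions off \<open>verts H\<close> below only fix the representative.\<close>

definition eigenspace :: "('v, 'z) multigraph_scheme \<Rightarrow> real \<Rightarrow> ('v \<Rightarrow> real) set" where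
  "eigenspace H \<theta> =
    {f. (\<forall>x. x \<notin> verts H \<longrightarrow> f x = 0) \<and> (\<forall>x\<in>verts H. laplacian H f x = \<theta> * f x)}"

definition spectrum :: "('v, 'z) multigraph_scheme \<Rightarrow> real set" where
  "spectrum H = {\<theta>. \<exists>f\<in>eigenspace H \<theta>. f \<noteq> (\<lambda>_. 0)}"

definition dirichlet_eigenspace :: "('v, 'z) bgraph_scheme \<Rightarrow> real \<Rightarrow> ('v \<Rightarrow> real) set" where
  "dirichlet_eigenspace H \<theta> =
    {f. (\<forall>x. x \<notin> verts H \<longrightarrow> f x = 0) \<and> (\<forall>x\<in>boundary H. f x = 0) \<and>
        (\<forall>x\<in>verts H - boundary H. laplacian H f x = \<theta> * f x)}"

definition dirichlet_spectrum :: "('v, 'z) bgraph_scheme \<Rightarrow> real set" where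
  "dirichlet_spectrum H = {\<theta>. \<exists>f\<in>dirichlet_eigenspace H \<theta>. f \<noteq> (\<lambda>_. 0)}"

global_interpretation fun_space: vector_space "\<lambda>(c :: real) (f :: 'v \<Rightarrow> real) x. c * f x"
  by unfold_locales (auto simp: fun_eq_iff algebra_simps)

text \<open>The Laplacian is self-adjoint, so geometric and algebraic multiplicities agree.\<close>

definition eig_mult :: "('v, 'z) multigraph_scheme \<Rightarrow> real \<Rightarrow> nat" where
  "eig_mult H \<theta> = fun_space.dim (eigenspace H \<theta>)"

section \<open>The graphs \<open>G\<^sub>n\<close> and \<open>\<Gamma>\<^sub>n\<close>\<close>

text \<open>\<open>Copy i\<close> labels the vertices of the \<open>i\<close>-th copy of an earlier graph, which makes the union of
  the copies disjoint; \<open>Glued\<close> is the single vertex resulting from an identification.\<close>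

datatype vertex = Base nat | Glued | Copy nat vertex

definition glue :: "nat \<Rightarrow> vertex set \<Rightarrow> vertex \<Rightarrow> vertex" where
  "glue i S v = (if v \<in> S then Glued else Copy i v)"

abbreviation glue_verts :: "nat \<Rightarrow> vertex set \<Rightarrow> (vertex, 'z) multigraph_scheme \<Rightarrow> vertex set" where
  "glue_verts i S H \<equiv> glue i S ` verts H"

abbreviation glue_edges ::
  "nat \<Rightarrow> vertex set \<Rightarrow> (vertex, 'z) multigraph_scheme \<Rightarrow> vertex uprod multiset" where
  "glue_edges i S H \<equiv> image_mset (map_uprod (glue i S)) (edges H)"

text \<open>Each \<open>G\<^sub>n\<close> has an automorphism exchanging its two ends, so it does not matter which end of the
  copies of \<open>G\<^sub>n\<^sub>-\<^sub>2\<close> is glued; we glue the first one.\<close>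

fun G :: "nat \<Rightarrow> vertex bgraph" where
  "G 0 =
    \<lparr>verts = {Base 0, Base 1},
     edges = {#Upair (Base 0) (Base 1)#},
     ends = (Base 0, Base 1)\<rparr>"
| "G (Suc 0) =
    \<lparr>verts = {Base 0, Base 1, Base 2},
     edges = {#Upair (Base 0) (Base 1), Upair (Base 1) (Base 2), Upair (Base 1) (Base 1)#},
     ends = (Base 0, Base 2)\<rparr>"
| "G (Suc (Suc n)) =
    (let H = G (Suc n); K = G n; a = fst (ends K); b = snd (ends K) in
      \<lparr>verts = glue_verts 0 (boundary H) H \<union> glue_verts 1 {a} K \<union> glue_verts 2 {a} K,
       edges = glue_edges 0 (boundary H) H + glue_edges 1 {a} K + glue_edges 2 {a} K,
       ends = (Copy 1 b, Copy 2 b)\<rparr>)"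

fun \<Gamma> :: "nat \<Rightarrow> vertex multigraph" where
  "\<Gamma> 0 = \<lparr>verts = {Base 0}, edges = {#Upair (Base 0) (Base 0), Upair (Base 0) (Base 0)#}\<rparr>"
| "\<Gamma> (Suc n) =
    (let H = G (Suc n); K = G n in
      \<lparr>verts = glue_verts 0 (boundary H) H \<union> glue_verts 1 (boundary K) K,
       edges = glue_edges 0 (boundary H) H + glue_edges 1 (boundary K) K\<rparr>)"

section \<open>The polynomials \<open>\<gamma>\<^sub>n\<close> and the spectral measures\<close>

definition born :: "nat \<Rightarrow> real set" where
  "born n = {\<theta> \<in> dirichlet_spectrum (G n). \<forall>m<n. \<theta> \<notin> dirichlet_spectrum (G m)}"

definition \<gamma> :: "nat \<Rightarrow> real poly" where
  "\<gamma> n = (\<Prod>\<theta>\<in>born n. [:- \<theta>, 1:])"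

definition \<nu> :: "nat \<Rightarrow> real measure" where
  "\<nu> n = measure_of UNIV (sets borel)
    (\<lambda>A. ennreal (1 / 2 ^ n) *
         (\<Sum>\<theta>\<in>spectrum (\<Gamma> n). of_nat (eig_mult (\<Gamma> n) \<theta>) * emeasure (return borel \<theta>) A))"

text \<open>The outer sum over \<open>k \<ge> 3\<close> is written with \<open>k = j + 3\<close>, hence \<open>\<gamma>\<^sub>k\<^sub>-\<^sub>2 = \<gamma>\<^sub>j\<^sub>+\<^sub>1\<close>.\<close>

definition \<mu> :: "real measure" where
  "\<mu> = measure_of UNIV (sets borel)
    (\<lambda>A. ennreal (2 / 3) *
         (\<Sum>j. ennreal (1 / 2 ^ (j + 3)) *
           (\<Sum>\<theta> | poly (\<gamma> (j + 1)) \<theta> = 0. emeasure (return borel \<theta>) A)))"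

text \<open>The set functions above are countably additive, so \<open>measure_of\<close> really yields measures
  with these values.\<close>

lemma countably_additive_emeasure:
  "sets M = \<A> \<Longrightarrow> countably_additive \<A> (emeasure M)"
  using emeasure_countably_additive[of M] by simp

lemma countably_additive_cmult:
  fixes f :: "'a set \<Rightarrow> ennreal"
  assumes "countably_additive \<A> f"
  shows "countably_additive \<A> (\<lambda>A. c * f A)"
  using assms unfolding countably_additive_def by (simp add: ennreal_suminf_cmult)

lemma countably_additive_sum:
  fixes f :: "'i \<Rightarrow> 'a set \<Rightarrow> ennreal"
  assumes "\<And>i. i \<in> I \<Longrightarrow> countably_additive \<A> (f i)"
  shows "countably_additive \<A> (\<lambda>A. \<Sum>i\<in>I. f i A)"
  using assms unfolding countably_additive_def by (subst suminf_sum) auto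

lemma countably_additive_suminf:
  fixes f :: "nat \<Rightarrow> 'a set \<Rightarrow> ennreal"
  assumes "\<And>i. countably_additive \<A> (f i)"
  shows "countably_additive \<A> (\<lambda>A. \<Sum>i. f i A)"
  unfolding countably_additive_def
proof safe
  fix A :: "nat \<Rightarrow> 'a set"
  assume A: "range A \<subseteq> \<A>" "disjoint_family A" "\<Union> (range A) \<in> \<A>"
  have "(\<Sum>n. \<Sum>i. f i (A n)) = (\<Sum>i. \<Sum>n. f i (A n))"
    using nn_integral_suminf[of "\<lambda>i n. f i (A n)" "count_space UNIV"]
    by (simp add: nn_integral_count_space_nat)
  also have "\<dots> = (\<Sum>i. f i (\<Union> (range A)))"
    using assms A unfolding countably_additive_def by metis
  finally show "(\<Sum>n. \<Sum>i. f i (A n)) = (\<Sum>i. f i (\<Union> (range A)))" .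
qed

lemma sets_\<nu> [simp, measurable_cong]: "sets (\<nu> n) = sets borel"
  unfolding \<nu>_def using sets.sigma_sets_eq[of "borel :: real measure"] by simp

lemma sets_\<mu> [simp, measurable_cong]: "sets \<mu> = sets borel"
  unfolding \<mu>_def using sets.sigma_sets_eq[of "borel :: real measure"] by simp

lemma emeasure_\<nu>:
  assumes "A \<in> sets borel"
  shows "emeasure (\<nu> n) A = ennreal (1 / 2 ^ n) *
    (\<Sum>\<theta>\<in>spectrum (\<Gamma> n). of_nat (eig_mult (\<Gamma> n) \<theta>) * emeasure (return borel \<theta>) A)"
  unfolding \<nu>_def
proof (rule emeasure_measure_of_sigma)
  show "sigma_algebra UNIV (sets (borel :: real measure))"
    using sets.sigma_algebra_axioms[of "borel :: real measure"] by simp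
qed (use assms in \<open>auto simp: positive_def
      intro!: countably_additive_cmult countably_additive_sum countably_additive_emeasure\<close>)

lemma emeasure_\<mu>:
  assumes "A \<in> sets borel"
  shows "emeasure \<mu> A = ennreal (2 / 3) *
    (\<Sum>j. ennreal (1 / 2 ^ (j + 3)) *
      (\<Sum>\<theta> | poly (\<gamma> (j + 1)) \<theta> = 0. emeasure (return borel \<theta>) A))"
  unfolding \<mu>_def
proof (rule emeasure_measure_of_sigma)
  show "sigma_algebra UNIV (sets (borel :: real measure))"
    using sets.sigma_algebra_axioms[of "borel :: real measure"] by simp
qed (use assms in \<open>auto simp: positive_def
      intro!: countably_additive_cmult countably_additive_suminf countably_additive_sum
        countably_additive_emeasure\<close>)

end

(*
  Fix a real number \<theta> and record, for every solution of the eigenvalue equation inside G_n, its two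
  boundary values and the two outward flows.  The gluing expresses the resulting plane in R^4 through
  those of G_(n-1) and G_(n-2).  As long as \<theta> is not a Dirichlet eigenvalue it is the graph of a
  symmetric matrix with rows (A, B) and (B, A), B nonzero.  If \<theta> is born at level k, an explicit
  computation shows that from then on the plane alternates between two degenerate shapes, that all
  Dirichlet eigenfunctions vanish at the glued vertex, and hence that the multiplicity at level k + j
  is a universal sequence asymptotic to 2^j / 9.  Extending Dirichlet eigenfunctions by zero bounds the
  mass of \<theta> in the spectral measures of the closed graphs below by (2/3) 2^-(k+2) in the limit.
  Since the Dirichlet Laplacian is diagonalizable, counting its eigenvalues by birth level shows that
  these lower bounds add up to 1, so no mass is left over and they are attained.
*)

theory Submission
  imports Defs "HOL-Computational_Algebra.Fundamental_Theorem_Algebra"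
begin

section \<open>Dimensions of subspaces\<close>

text \<open>The obstacle is that a Dirichlet-to-Neumann matrix has a pole at exactly the values of
  \<theta> under study. Keeping its graph as a relation between values and flows lets one gluing
  rule pass through the poles. The constants fit together as follows. \<open>G n\<close> has about
  (2/3) 2^n inner vertices, of which an eigenvalue born at level k accounts for about 2^(n-k) / 9,
  so the sum over k of 2^-k times the number of births at level k is (2/3) / (1/9) = 6. The two
  pieces of \<open>\<Gamma> n\<close> supply multiplicity about 2^(n-k) (1/9 + 1/18) = 2^(n-k) / 6,
  that is mass 2^-k / 6, and 6 / 6 = 1. Each \<open>\<Gamma> n\<close> mixes many birth levels, and
  limits taken level by level would permit mass to escape to ever later births. The count on
  \<open>G n\<close> excludes this. Upper bounds for single multiplicities on
  \<open>\<Gamma> n\<close> are thereby avoided: eigenfunctions that do not vanish at the glued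
  vertex are never examined, only the total number 2^n of eigenvalues enters.\<close>

context vector_space
begin

text \<open>\<open>dim\<close> is 0 for a space without finite basis, so monotonicity fails in the
  infinite-dimensional space of all functions. The finite set \<open>T\<close> keeps both spaces
  finite-dimensional; it recurs below for the same reason.\<close>

lemma dim_le_of_subset:
  assumes "V \<subseteq> W" "finite T" "W \<subseteq> span T"
  shows "dim V \<le> dim W"
proof -
  obtain C where C: "C \<subseteq> W" "independent C" "W \<subseteq> span C" "card C = dim W"
    by (rule basis_exists)
  have "finite C"
    using independent_span_bound[OF assms(2) C(2)] C(1) assms(3) by auto
  then show ?thesis
    using dim_le_card[of V C] C assms(1) by auto
qed

lemma dim_direct_sum:
  assumes V: "subspace V" and W: "subspace W" and int: "V \<inter> W \<subseteq> {0}"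
    and T: "finite T" "V \<subseteq> span T" "W \<subseteq> span T"
  shows "dim {x + y |x y. x \<in> V \<and> y \<in> W} = dim V + dim W"
proof -
  obtain B where B: "B \<subseteq> V" "independent B" "V \<subseteq> span B" "card B = dim V"
    by (rule basis_exists)
  obtain C where C: "C \<subseteq> W" "independent C" "W \<subseteq> span C" "card C = dim W"
    by (rule basis_exists)
  have fin: "finite B" "finite C"
    using independent_span_bound[OF T(1) B(2)] independent_span_bound[OF T(1) C(2)] B C T by auto
  have "0 \<notin> B"
    using B(2) dependent_zero by blast
  then have disj: "B \<inter> C = {}"
    using int B(1) C(1) by blast
  have "independent (B \<union> C)"
  proof (rule independent_if_scalars_zero)
    show "finite (B \<union> C)"
      using fin by simp
    fix u x
    assume 0: "(\<Sum>v\<in>B \<union> C. scale (u v) v) = 0" and x: "x \<in> B \<union> C"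
    define b c where "b = (\<Sum>v\<in>B. scale (u v) v)" and "c = (\<Sum>v\<in>C. scale (u v) v)"
    have bc: "b + c = 0"
      using 0 fin disj by (simp add: sum.union_disjoint b_def c_def)
    have "b \<in> V"
      unfolding b_def using V B(1) by (intro subspace_sum subspace_scale) auto
    have "c \<in> W"
      unfolding c_def using W C(1) by (intro subspace_sum subspace_scale) auto
    moreover have "b = - c"
      using bc by (simp add: eq_neg_iff_add_eq_0)
    ultimately have "b \<in> W"
      using W subspace_neg by blast
    then have "b = 0"
      using \<open>b \<in> V\<close> int by blast
    then have "c = 0"
      using bc by simp
    show "u x = 0"
      using x \<open>b = 0\<close> \<open>c = 0\<close> B(2) C(2) fin
      unfolding b_def c_def independent_explicit_finite_subsets by blast
  qed
  moreover have "B \<union> C \<subseteq> {x + y |x y. x \<in> V \<and> y \<in> W}"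
    using B(1) C(1) subspace_0[OF V] subspace_0[OF W]
    by (auto intro: exI[of _ 0] add.right_neutral[symmetric] add.left_neutral[symmetric])
  moreover have "{x + y |x y. x \<in> V \<and> y \<in> W} \<subseteq> span (B \<union> C)"
    using B(3) C(3) span_mono[of B "B \<union> C"] span_mono[of C "B \<union> C"]
    by (auto intro!: span_add)
  moreover have "card (B \<union> C) = dim V + dim W"
    using fin disj B(4) C(4) by (simp add: card_Un_disjoint)
  ultimately show ?thesis
    using dim_unique by blast
qed

text \<open>One linear condition costs exactly one dimension unless it holds identically. In the
  applications \<open>V\<close> is a space of functions on a glued graph and \<open>\<phi>\<close>
  is the Laplacian, or the value, at the glued vertex.\<close>

lemma dim_kernel:
  assumes V: "subspace V" and T: "finite T" "V \<subseteq> span T"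
    and add: "\<And>x y. \<phi> (x + y) = \<phi> x + \<phi> y" and \<phi>_scale: "\<And>c x. \<phi> (scale c x) = c * \<phi> x"
  shows "dim V = dim {x \<in> V. \<phi> x = 0} + (if \<forall>x\<in>V. \<phi> x = 0 then 0 else 1)"
proof (cases "\<forall>x\<in>V. \<phi> x = 0")
  case True
  then have "{x \<in> V. \<phi> x = 0} = V"
    by auto
  then show ?thesis
    using True by simp
next
  case False
  then obtain x0 where x0: "x0 \<in> V" "\<phi> x0 \<noteq> 0"
    by blast
  have \<phi>0: "\<phi> 0 = 0"
    using \<phi>_scale[of 0 0] by simp
  let ?K = "{x \<in> V. \<phi> x = 0}"
  have K: "subspace ?K"
    using V by (auto simp: subspace_def add \<phi>_scale \<phi>0)
  have L: "span {x0} \<subseteq> V"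
    using x0 V by (simp add: span_minimal)
  have *: "V = {x + y |x y. x \<in> ?K \<and> y \<in> span {x0}}"
  proof (intro equalityI subsetI)
    fix x assume x: "x \<in> V"
    define c where "c = \<phi> x / \<phi> x0"
    have "scale c x0 \<in> V"
      using V x0 by (simp add: subspace_scale)
    then have "x - scale c x0 \<in> V"
      using V x by (simp add: subspace_diff)
    moreover have "\<phi> (x - scale c x0) = 0"
      using add[of "x - scale c x0" "scale c x0"] x0 by (simp add: \<phi>_scale c_def)
    moreover have "scale c x0 \<in> span {x0}"
      by (simp add: span_base span_scale)
    moreover have "x = (x - scale c x0) + scale c x0"
      by simp
    ultimately show "x \<in> {x + y |x y. x \<in> ?K \<and> y \<in> span {x0}}"
      unfolding mem_Collect_eq by metis
  next
    fix z assume "z \<in> {x + y |x y. x \<in> ?K \<and> y \<in> span {x0}}"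
    then obtain x y where "z = x + y" "x \<in> V" "y \<in> V"
      using L by auto
    then show "z \<in> V"
      using subspace_add[OF V] by simp
  qed
  have int: "?K \<inter> span {x0} \<subseteq> {0}"
    using x0 by (auto simp: span_singleton \<phi>_scale)
  have "x0 \<noteq> 0"
    using x0 \<phi>0 by auto
  then have "dim (span {x0}) = 1"
    by (subst dim_span_eq_card_independent) auto
  then have "dim V = dim ?K + 1"
    using dim_direct_sum[OF K subspace_span int T(1)] L T(2) * by auto
  then show ?thesis
    using False by simp
qed

end

lemma (in vector_space_pair) dim_injective_image:
  assumes "Vector_Spaces.linear s1 s2 f" "inj f"
  shows "vs2.dim (f ` V) = vs1.dim V"
proof -
  obtain B where B: "B \<subseteq> V" "vs1.independent B" "V \<subseteq> vs1.span B" "card B = vs1.dim V"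
    by (rule vs1.basis_exists)
  have "f ` V \<subseteq> vs2.span (f ` B)"
    using B(3) linear_span_image[OF assms(1), of B] by auto
  moreover have "vs2.independent (f ` B)"
    by (rule linear_independent_injective_image[OF assms(1) B(2) inj_on_subset[OF assms(2) subset_UNIV]])
  moreover have "card (f ` B) = vs1.dim V"
    using B(4) card_image[OF inj_on_subset[OF assms(2) subset_UNIV], of B] by simp
  ultimately show ?thesis
    using B(1) by (intro vs2.dim_unique[of "f ` B"]) auto
qed

global_interpretation fun_space_pair: vector_space_pair
  "\<lambda>(c :: real) (f :: 'v \<Rightarrow> real) x. c * f x" "\<lambda>(c :: real) (f :: 'w \<Rightarrow> real) x. c * f x"
  ..

definition supported :: "'v set \<Rightarrow> ('v \<Rightarrow> real) set" where
  "supported X = {f. \<forall>x. x \<notin> X \<longrightarrow> f x = 0}"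

lemma sum_fun_apply: "(\<Sum>i\<in>I. F i) x = (\<Sum>i\<in>I. (F i :: 'v \<Rightarrow> real) x)"
  by (induction I rule: infinite_finite_induct) auto

lemma subspace_supported: "fun_space.subspace (supported X)"
  by (auto simp: fun_space.subspace_def supported_def)

lemma
  assumes "finite X"
  shows supported_subset_span: "supported X \<subseteq> fun_space.span ((\<lambda>x. indicator {x}) ` X)" (is ?A)
    and dim_supported: "fun_space.dim (supported X) = card X" (is ?B)
proof -
  let ?b = "\<lambda>x. indicator {x} :: 'a \<Rightarrow> real"
  have inj: "inj_on ?b X"
    by (auto simp: inj_on_def indicator_def fun_eq_iff split: if_splits)
  have expand: "f = (\<Sum>x\<in>X. (\<lambda>y. f x * ?b x y))" if "f \<in> supported X" for f
  proof
    fix y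
    have "(\<Sum>x\<in>X. f x * ?b x y) = (\<Sum>x\<in>X. if x = y then f x else 0)"
      by (rule sum.cong) (auto simp: indicator_def)
    then show "f y = (\<Sum>x\<in>X. (\<lambda>y. f x * ?b x y)) y"
      using that assms by (auto simp: sum_fun_apply supported_def)
  qed
  show A: ?A
  proof
    fix f :: "'a \<Rightarrow> real" assume "f \<in> supported X"
    then show "f \<in> fun_space.span (?b ` X)"
    proof (subst expand)
      show "(\<Sum>x\<in>X. (\<lambda>y. f x * ?b x y)) \<in> fun_space.span (?b ` X)"
        by (intro fun_space.span_sum fun_space.span_scale fun_space.span_base imageI)
    qed
  qed
  have "fun_space.independent (?b ` X)"
  proof (rule fun_space.independent_if_scalars_zero)
    fix u :: "('a \<Rightarrow> real) \<Rightarrow> real" and b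
    assume 0: "(\<Sum>b\<in>?b ` X. (\<lambda>y. u b * b y)) = 0" and "b \<in> ?b ` X"
    then obtain x where x: "x \<in> X" "b = ?b x"
      by auto
    have "(\<Sum>b\<in>?b ` X. (\<lambda>y. u b * b y)) x = (\<Sum>z\<in>X. u (?b z) * ?b z x)"
      using inj by (simp add: sum_fun_apply sum.reindex)
    also have "\<dots> = u b"
      using x assms by (simp add: indicator_def if_distrib cong: if_cong)
    finally show "u b = 0"
      using 0 by simp
  qed (use assms in simp)
  moreover have "?b ` X \<subseteq> supported X"
    by (auto simp: supported_def indicator_def)
  ultimately show ?B
    using A inj by (intro fun_space.dim_unique[of "?b ` X"]) (auto simp: card_image)
qed

lemma dim_le_of_supported:
  assumes "finite X" "V \<subseteq> W" "W \<subseteq> supported X"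
  shows "fun_space.dim V \<le> fun_space.dim W"
  using fun_space.dim_le_of_subset[OF assms(2), of "(\<lambda>x. indicator {x}) ` X"]
    supported_subset_span[OF assms(1)] assms by auto

section \<open>Symmetric operators\<close>

text \<open>The factor belonging to a non-real root a + ib is written as (X - a)^2 + b^2, the form
  to which positivity is applied later.\<close>

lemma real_poly_factor:
  fixes p :: "real poly"
  assumes "degree p \<noteq> 0"
  obtains (linear) r q where "p = [:-r, 1:] * q"
    | (quadratic) a b q where "b \<noteq> 0" "p = ([:-a, 1:] * [:-a, 1:] + [:b * b:]) * q"
proof -
  let ?c = "map_poly complex_of_real"
  have c_add: "?c (p + q) = ?c p + ?c q" for p q
    by (rule poly_eqI) (simp add: coeff_map_poly)
  have c_smult: "?c (smult u p) = smult (of_real u) (?c p)" for u p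
    by (rule poly_eqI) (simp add: coeff_map_poly)
  have c_mult: "?c (p * q) = ?c p * ?c q" for p q
    by (induction p) (simp_all add: map_poly_pCons c_add c_smult)
  have c_real: "poly (?c p) (of_real x) = of_real (poly p x)" for p x
    by (induction p) (simp_all add: map_poly_pCons)
  have "\<not> constant (poly (?c p))"
    using assms by (simp add: constant_degree degree_map_poly)
  then obtain z where z: "poly (?c p) z = 0"
    using fundamental_theorem_of_algebra by blast
  show ?thesis
  proof (cases "Im z = 0")
    case True
    then have "z = of_real (Re z)"
      by (simp add: complex_eq_iff)
    then have "of_real (poly p (Re z)) = (0 :: complex)"
      using z c_real by metis
    then have "[:- Re z, 1:] dvd p"
      by (simp add: poly_eq_0_iff_dvd)
    then show ?thesis
      using linear by (auto elim: dvdE)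
  next
    case False
    define a b where "a = Re z" and "b = Im z"
    define s :: "real poly" where "s = [:-a, 1:] * [:-a, 1:] + [:b * b:]"
    have s_eq: "s = [:a * a + b * b, - (2 * a), 1:]"
      by (simp add: s_def)
    have sz: "poly (?c s) z = 0"
      by (simp add: s_eq a_def b_def complex_eq_iff map_poly_pCons algebra_simps)
    have "degree s = 2" "s \<noteq> 0"
      by (auto simp: s_eq)
    \<comment> \<open>The remainder is real of degree at most one and vanishes at a non-real point,
      so it is 0. This gives real divisibility without splitting over the complex numbers.\<close>
    define r where "r = p mod s"
    have "?c p = ?c (p div s) * ?c s + ?c r"
      unfolding c_mult[symmetric] c_add[symmetric] r_def by simp
    then have rz: "poly (?c r) z = 0"
      using z sz by simp
    have "degree r < 2"
      using degree_mod_less[OF \<open>s \<noteq> 0\<close>, of p] \<open>degree s = 2\<close> by (auto simp: r_def)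
    then have r: "r = [:coeff r 0, coeff r 1:]"
      by (intro poly_eqI) (auto simp: coeff_pCons coeff_eq_0 split: nat.split)
    have "poly (?c [:coeff r 0, coeff r 1:]) z = 0"
      using rz r by simp
    then have "coeff r 1 * Im z = 0" "coeff r 0 + coeff r 1 * Re z = 0"
      by (auto simp: map_poly_pCons complex_eq_iff mult.commute)
    then have "r = 0"
      using False r by auto
    then have "p = ([:-a, 1:] * [:-a, 1:] + [:b * b:]) * (p div s)"
      using div_mult_mod_eq[of p s] unfolding s_def[symmetric] by (simp add: r_def mult.commute)
    moreover have "b \<noteq> 0"
      using False by (simp add: b_def)
    ultimately show ?thesis
      using quadratic by blast
  qed
qed

locale symmetric_operator =
  fixes X :: "'v set" and T :: "('v \<Rightarrow> real) \<Rightarrow> 'v \<Rightarrow> real"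
  assumes finite_X: "finite X"
    and T_add: "T (f + g) = T f + T g"
    and T_scale: "T (\<lambda>x. c * f x) = (\<lambda>x. c * T f x)"
    and T_supported: "T f \<in> supported X"
    and T_symmetric: "f \<in> supported X \<Longrightarrow> g \<in> supported X \<Longrightarrow>
      (\<Sum>x\<in>X. T f x * g x) = (\<Sum>x\<in>X. f x * T g x)"
begin

definition E :: "real \<Rightarrow> ('v \<Rightarrow> real) set" where
  "E \<theta> = {f \<in> supported X. T f = (\<lambda>x. \<theta> * f x)}"

definition point_spectrum :: "real set" where
  "point_spectrum = {\<theta>. \<exists>f\<in>E \<theta>. f \<noteq> 0}"

lemma T_0: "T 0 = 0"
  using T_scale[of 0 0] by (simp add: zero_fun_def)

lemma subspace_E: "fun_space.subspace (E \<theta>)"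
proof (rule fun_space.subspaceI)
  show "0 \<in> E \<theta>"
    by (simp add: E_def supported_def T_0) (simp add: zero_fun_def)
  show "f + g \<in> E \<theta>" if "f \<in> E \<theta>" "g \<in> E \<theta>" for f g
    using that by (simp add: E_def supported_def T_add) (simp add: plus_fun_def distrib_left)
  show "(\<lambda>x. c * f x) \<in> E \<theta>" if "f \<in> E \<theta>" for c f
    using that by (simp add: E_def supported_def T_scale mult.left_commute)
qed

lemma sum_squares_supported:
  assumes "f \<in> supported X" "(\<Sum>x\<in>X. f x * f x) = 0"
  shows "f = 0"
proof -
  have "\<forall>x\<in>X. f x * f x = 0"
    using assms(2) finite_X by (subst (asm) sum_nonneg_eq_0_iff) auto
  then show ?thesis
    using assms(1) by (auto simp: supported_def fun_eq_iff)
qed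

lemma E_orthogonal:
  assumes "f \<in> E \<theta>" "g \<in> E \<eta>" "\<theta> \<noteq> \<eta>"
  shows "(\<Sum>x\<in>X. f x * g x) = 0"
proof -
  have "\<theta> * (\<Sum>x\<in>X. f x * g x) = (\<Sum>x\<in>X. T f x * g x)"
    using assms by (simp add: E_def sum_distrib_left mult.assoc)
  also have "\<dots> = (\<Sum>x\<in>X. f x * T g x)"
    using assms by (intro T_symmetric) (auto simp: E_def)
  also have "\<dots> = \<eta> * (\<Sum>x\<in>X. f x * g x)"
    using assms by (simp add: E_def sum_distrib_left mult_ac)
  finally show ?thesis
    using assms(3) by auto
qed

text \<open>Distinct eigenspaces are orthogonal, so in the induction the new one meets the span of
  the others only in 0, by definiteness of the sum of squares.\<close>

lemma dim_span_E:
  assumes "finite F"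
  shows "fun_space.dim (fun_space.span (\<Union>\<theta>\<in>F. E \<theta>)) = (\<Sum>\<theta>\<in>F. fun_space.dim (E \<theta>))"
  using assms
proof (induction F)
  case empty
  then show ?case
    using fun_space.dim_eq_card[of "{}" "{0}"] fun_space.independent_empty by simp
next
  case (insert \<theta> F)
  let ?S = "fun_space.span (\<Union>\<theta>\<in>F. E \<theta>)"
  have E: "E \<eta> \<subseteq> supported X" for \<eta>
    by (auto simp: E_def)
  have S: "?S \<subseteq> supported X"
    using E subspace_supported by (intro fun_space.span_minimal) auto
  have "(\<Sum>x\<in>X. f x * g x) = 0" if f: "f \<in> E \<theta>" and g: "g \<in> ?S" for f g
    using g
  proof (induction rule: fun_space.span_induct_alt)
    case (step c y z)
    then obtain \<eta> where "\<eta> \<in> F" "y \<in> E \<eta>"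
      by auto
    then have "(\<Sum>x\<in>X. f x * y x) = 0"
      using E_orthogonal[OF f] insert.hyps by metis
    moreover have "(\<Sum>x\<in>X. f x * ((\<lambda>x. c * y x) + z) x)
        = c * (\<Sum>x\<in>X. f x * y x) + (\<Sum>x\<in>X. f x * z x)"
      by (simp add: algebra_simps sum.distrib sum_distrib_left)
    ultimately show ?case
      using step by simp
  qed simp
  then have int: "E \<theta> \<inter> ?S \<subseteq> {0}"
    using sum_squares_supported E by blast
  have "fun_space.span (\<Union>\<theta>\<in>insert \<theta> F. E \<theta>) = {x + y |x y. x \<in> E \<theta> \<and> y \<in> ?S}"
    using subspace_E[of \<theta>] by (simp add: fun_space.span_Un fun_space.span_eq_iff[THEN iffD2])
  then show ?case
    using insert fun_space.dim_direct_sum[OF subspace_E fun_space.subspace_span int,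
        of "(\<lambda>x. indicator {x}) ` X"] finite_X
      order.trans[OF E[of \<theta>] supported_subset_span[OF finite_X]]
      order.trans[OF S supported_subset_span[OF finite_X]] by simp
qed

lemma sum_dim_E_le:
  assumes "finite F"
  shows "(\<Sum>\<theta>\<in>F. fun_space.dim (E \<theta>)) \<le> card X"
proof -
  have "fun_space.span (\<Union>\<theta>\<in>F. E \<theta>) \<subseteq> supported X"
    using subspace_supported by (intro fun_space.span_minimal) (auto simp: E_def)
  then show ?thesis
    using dim_span_E[OF assms] dim_le_of_supported[OF finite_X] dim_supported[OF finite_X]
    by (metis order_refl)
qed

lemma dim_E_pos:
  assumes "\<theta> \<in> point_spectrum"
  shows "0 < fun_space.dim (E \<theta>)"
proof -
  obtain f where f: "f \<in> E \<theta>" "f \<noteq> 0"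
    using assms by (auto simp: point_spectrum_def)
  have "fun_space.dim {f} = 1"
    using f by (subst fun_space.dim_eq_card_independent) auto
  then show ?thesis
    using dim_le_of_supported[OF finite_X, of "{f}" "E \<theta>"] f by (auto simp: E_def)
qed

lemma finite_point_spectrum: "finite point_spectrum"
proof (rule ccontr)
  assume "infinite point_spectrum"
  then obtain F where F: "F \<subseteq> point_spectrum" "finite F" "card F = Suc (card X)"
    by (meson infinite_arbitrarily_large)
  have "card F = (\<Sum>\<theta>\<in>F. 1)"
    by simp
  also have "\<dots> \<le> (\<Sum>\<theta>\<in>F. fun_space.dim (E \<theta>))"
    using dim_E_pos F(1) by (intro sum_mono) (auto simp: Suc_leI)
  also have "\<dots> \<le> card X"
    by (rule sum_dim_E_le[OF F(2)])
  finally show False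
    using F(3) by simp
qed

section \<open>Polynomials p(T) in a symmetric operator, and diagonalization\<close>

definition poly_op :: "real poly \<Rightarrow> ('v \<Rightarrow> real) \<Rightarrow> 'v \<Rightarrow> real" where
  "poly_op p = fold_coeffs (\<lambda>a F f x. a * f x + T (F f) x) p (\<lambda>f. 0)"

lemma poly_op_0 [simp]: "poly_op 0 f = 0"
  by (simp add: poly_op_def)

lemma poly_op_pCons [simp]: "poly_op (pCons a p) f = (\<lambda>x. a * f x + T (poly_op p f) x)"
proof (cases "p = 0 \<and> a = 0")
  case True
  then show ?thesis
    by (auto simp: T_0 fun_eq_iff)
next
  case False
  then show ?thesis
    by (auto simp: poly_op_def)
qed

lemma T_lincomb: "T (\<lambda>x. a * f x + b * g x) = (\<lambda>x. a * T f x + b * T g x)"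
  using T_add[of "\<lambda>x. a * f x" "\<lambda>x. b * g x"] T_scale[of a f] T_scale[of b g]
  by (simp add: plus_fun_def)

lemma poly_op_lincomb:
  "poly_op p (\<lambda>x. a * f x + b * g x) = (\<lambda>x. a * poly_op p f x + b * poly_op p g x)"
  by (induction p) (simp add: zero_fun_def, simp add: T_lincomb algebra_simps)

lemma poly_op_add: "poly_op (p + q) f = (\<lambda>x. poly_op p f x + poly_op q f x)"
proof (induction p arbitrary: q)
  case (pCons a p)
  obtain b r where q: "q = pCons b r"
    by (cases q)
  show ?case
    using T_lincomb[of 1 "poly_op p f" 1 "poly_op r f"]
    by (simp add: q pCons.IH fun_eq_iff algebra_simps)
qed simp

lemma poly_op_smult: "poly_op (smult c p) f = (\<lambda>x. c * poly_op p f x)"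
  by (induction p) (simp add: zero_fun_def, simp add: T_scale algebra_simps)

lemma poly_op_mult: "poly_op (p * q) f = poly_op p (poly_op q f)"
  by (induction p) (simp_all add: poly_op_add poly_op_smult)

lemma poly_op_supported: "f \<in> supported X \<Longrightarrow> poly_op p f \<in> supported X"
  using T_supported by (induction p) (auto simp: supported_def)

lemma poly_op_E:
  assumes "f \<in> E \<theta>"
  shows "poly_op p f = (\<lambda>x. poly p \<theta> * f x)"
proof (induction p)
  case (pCons a p)
  have "T (poly_op p f) = (\<lambda>x. poly p \<theta> * (\<theta> * f x))"
    using pCons.IH T_scale[of "poly p \<theta>" f] assms by (simp add: E_def)
  then show ?case
    by (simp add: algebra_simps)
qed (simp add: zero_fun_def)

lemma poly_op_monom: "poly_op (monom c n) f = (\<lambda>x. c * (T ^^ n) f x)"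
  by (induction n) (simp_all add: monom_0 monom_Suc T_scale T_0)

lemma poly_op_sum: "poly_op (\<Sum>i\<in>I. p i) f = (\<Sum>i\<in>I. poly_op (p i) f)"
  by (induction I rule: infinite_finite_induct) (auto simp: poly_op_add fun_eq_iff)

lemma poly_op_square_add: "poly_op (q * q + [:c:]) f = (\<lambda>x. poly_op q (poly_op q f) x + c * f x)"
  by (simp only: poly_op_add poly_op_mult) (simp add: T_0)

text \<open>The \<open>card X + 1\<close> iterates of \<open>f\<close> lie in a space of dimension
  \<open>card X\<close>, so they are dependent. Coinciding iterates are treated separately because a
  set forgets repetitions.\<close>

lemma annihilating_poly:
  assumes f: "f \<in> supported X"
  obtains p where "p \<noteq> 0" "poly_op p f = 0"
proof (cases "inj_on (\<lambda>i. (T ^^ i) f) {..card X}")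
  case False
  then obtain i j where ij: "i \<noteq> j" "(T ^^ i) f = (T ^^ j) f"
    by (auto simp: inj_on_def)
  have "coeff (monom 1 i + monom (-1) j :: real poly) i = 1"
    using ij by simp
  then have "monom 1 i + monom (-1) j \<noteq> (0 :: real poly)"
    by (metis coeff_0 zero_neq_one)
  moreover have "poly_op (monom 1 i + monom (-1) j) f = 0"
    using ij by (simp add: poly_op_add poly_op_monom fun_eq_iff)
  ultimately show ?thesis
    using that by blast
next
  case True
  let ?S = "(\<lambda>i. (T ^^ i) f) ` {..card X}"
  have "(T ^^ i) f \<in> supported X" for i
    using f T_supported by (cases i) auto
  then have S: "?S \<subseteq> fun_space.span ((\<lambda>x. indicator {x}) ` X)"
    using supported_subset_span[OF finite_X] by blast
  have "card ?S = Suc (card X)"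
    using True by (simp add: card_image)
  moreover have "card ((\<lambda>x. indicator {x} :: 'v \<Rightarrow> real) ` X) \<le> card X"
    using finite_X by (rule card_image_le)
  ultimately have "fun_space.dependent ?S"
    using fun_space.independent_span_bound[OF _ _ S] finite_X by fastforce
  then obtain u v where u: "(\<Sum>g\<in>?S. (\<lambda>x. u g * g x)) = 0" and v: "v \<in> ?S" "u v \<noteq> 0"
    using fun_space.dependent_finite[of ?S] by auto
  define p where "p = (\<Sum>i\<le>card X. monom (u ((T ^^ i) f)) i)"
  obtain j where j: "j \<le> card X" "v = (T ^^ j) f"
    using v(1) by auto
  have "coeff p j = u v"
    using j by (simp add: p_def coeff_sum)
  then have "p \<noteq> 0"
    using v(2) by auto
  moreover have "poly_op p f = (\<Sum>g\<in>?S. (\<lambda>x. u g * g x))"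
    using True by (simp add: p_def poly_op_sum poly_op_monom sum.reindex)
  ultimately show ?thesis
    using that u by metis
qed

lemma T_minus_scalar_symmetric:
  assumes "f \<in> supported X" "g \<in> supported X"
  shows "(\<Sum>x\<in>X. poly_op [:-a, 1:] f x * g x) = (\<Sum>x\<in>X. f x * poly_op [:-a, 1:] g x)"
proof -
  have "(\<Sum>x\<in>X. poly_op [:-a, 1:] f x * g x)
      = (\<Sum>x\<in>X. T f x * g x) - a * (\<Sum>x\<in>X. f x * g x)"
    by (simp add: T_0 algebra_simps sum_subtractf sum_distrib_left)
  also have "\<dots> = (\<Sum>x\<in>X. f x * T g x) - a * (\<Sum>x\<in>X. f x * g x)"
    using T_symmetric[OF assms] by simp
  also have "\<dots> = (\<Sum>x\<in>X. f x * poly_op [:-a, 1:] g x)"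
    by (simp add: T_0 algebra_simps sum_subtractf sum_distrib_left)
  finally show ?thesis .
qed

text \<open>Positivity of \<open>(T - a)\<^sup>2 + b\<^sup>2\<close> shows that an annihilating polynomial of least degree
  has only real and simple roots.\<close>

lemma sum_squares_op_kernel:
  assumes f: "f \<in> supported X"
    and 0: "poly_op ([:-a, 1:] * [:-a, 1:] + [:b * b:]) f = 0"
  shows "poly_op [:-a, 1:] f = 0" and "b \<noteq> 0 \<Longrightarrow> f = 0"
proof -
  let ?g = "poly_op [:-a, 1:] f"
  have g: "?g \<in> supported X"
    using f by (rule poly_op_supported)
  have "0 = (\<Sum>x\<in>X. poly_op ([:-a, 1:] * [:-a, 1:] + [:b * b:]) f x * f x)"
    unfolding 0 by simp
  also have "\<dots> = (\<Sum>x\<in>X. poly_op [:-a, 1:] ?g x * f x) + b * b * (\<Sum>x\<in>X. f x * f x)"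
    unfolding poly_op_square_add by (simp add: distrib_right sum.distrib sum_distrib_left mult.assoc
        del: poly_op_pCons)
  also have "\<dots> = (\<Sum>x\<in>X. ?g x * ?g x) + b * b * (\<Sum>x\<in>X. f x * f x)"
    using T_minus_scalar_symmetric[OF g f] by simp
  finally have *: "(\<Sum>x\<in>X. ?g x * ?g x) + b * b * (\<Sum>x\<in>X. f x * f x) = 0"
    by simp
  have nonneg: "0 \<le> (\<Sum>x\<in>X. ?g x * ?g x)" "0 \<le> b * b * (\<Sum>x\<in>X. f x * f x)"
    by (simp_all add: sum_nonneg del: poly_op_pCons)
  then have "(\<Sum>x\<in>X. ?g x * ?g x) = 0" "b * b * (\<Sum>x\<in>X. f x * f x) = 0"
    using * by linarith+
  then show "?g = 0" "b \<noteq> 0 \<Longrightarrow> f = 0"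
    using sum_squares_supported f g by auto
qed

text \<open>Induction on the degree strips one real factor of \<open>p\<close>. A quadratic factor
  is injective by positivity. For a linear factor X - r the function \<open>w = poly_op q f\<close>
  is an eigenvector for \<open>r\<close> or 0, and either it is 0 (when \<open>r\<close> is also a
  root of \<open>q\<close>) or a multiple of it can be split off from \<open>f\<close>.\<close>

lemma poly_op_kernel_subset_span:
  assumes "p \<noteq> 0" "f \<in> supported X" "poly_op p f = 0"
  shows "f \<in> fun_space.span (\<Union>\<theta>. E \<theta>)"
  using assms
proof (induction "degree p" arbitrary: p f rule: less_induct)
  case less
  show ?case
  proof (cases "degree p = 0")
    case True
    then obtain a where "p = [:a:]"
      by (meson degree_eq_zeroE)
    then have "f = 0"
      using less.prems by (auto simp: T_0 fun_eq_iff)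
    then show ?thesis
      by (simp add: fun_space.span_zero)
  next
    case False
    from False show ?thesis
    proof (cases rule: real_poly_factor)
      case (linear r q)
      have "q \<noteq> 0"
        using less.prems(1) linear by auto
      have deg: "degree q < degree p"
        using \<open>q \<noteq> 0\<close> unfolding linear by (subst degree_mult_eq) auto
      define w where "w = poly_op q f"
      have w: "w \<in> supported X"
        using less.prems(2) by (simp add: w_def poly_op_supported)
      have w0: "poly_op [:-r, 1:] w = 0"
        using less.prems(3) by (simp only: linear w_def poly_op_mult)
      then have wE: "w \<in> E r"
        using w by (auto simp: E_def T_0 fun_eq_iff)
      show ?thesis
      proof (cases "poly q r = 0")
        case True
        then obtain s where s: "q = [:-r, 1:] * s"
          by (auto simp only: poly_eq_0_iff_dvd dvd_def)
        \<comment> \<open>Positivity with b = 0: the kernel of (T - r)^2 is that of T - r, so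
          repeated roots can be cancelled.\<close>
        have "poly_op ([:-r, 1:] * [:-r, 1:] + [:0 * 0:]) (poly_op s f) = 0"
          using w0 unfolding poly_op_square_add
          by (simp add: w_def s poly_op_mult zero_fun_def del: poly_op_pCons mult_pCons_left)
        then have "poly_op q f = 0"
          unfolding s poly_op_mult
          by (rule sum_squares_op_kernel(1)[OF poly_op_supported[OF less.prems(2)]])
        then show ?thesis
          using less.hyps[OF deg \<open>q \<noteq> 0\<close> less.prems(2)] by blast
      next
        case False
        \<comment> \<open>On \<open>w\<close> the operator q(T) is multiplication by
          \<open>poly q r\<close>, so this correction makes q(T) vanish on \<open>u\<close>.\<close>
        define u where "u = (\<lambda>x. 1 * f x + (- 1 / poly q r) * w x)"
        have "u \<in> supported X"
          using less.prems(2) w by (auto simp: supported_def u_def)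
        moreover have "poly_op q u = 0"
          unfolding u_def poly_op_lincomb poly_op_E[OF wE] w_def[symmetric]
          using False by (auto simp: fun_eq_iff)
        ultimately have "u \<in> fun_space.span (\<Union>\<theta>. E \<theta>)"
          using less.hyps[OF deg \<open>q \<noteq> 0\<close>] by blast
        moreover have "(\<lambda>x. (1 / poly q r) * w x) \<in> fun_space.span (\<Union>\<theta>. E \<theta>)"
          using wE by (intro fun_space.span_scale fun_space.span_base) auto
        ultimately have "u + (\<lambda>x. (1 / poly q r) * w x) \<in> fun_space.span (\<Union>\<theta>. E \<theta>)"
          by (rule fun_space.span_add)
        moreover have "u + (\<lambda>x. (1 / poly q r) * w x) = f"
          by (auto simp: u_def fun_eq_iff)
        ultimately show ?thesis
          by simp
      qed
    next
      case (quadratic a b q)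
      have "q \<noteq> 0"
        using less.prems(1) quadratic by auto
      have "degree ([:-a, 1:] * [:-a, 1:] + [:b * b:]) = 2" "[:-a, 1:] * [:-a, 1:] + [:b * b:] \<noteq> 0"
        by simp_all
      then have deg: "degree q < degree p"
        using \<open>q \<noteq> 0\<close> unfolding quadratic by (subst degree_mult_eq) auto
      have "poly_op ([:-a, 1:] * [:-a, 1:] + [:b * b:]) (poly_op q f) = 0"
        using less.prems(3) by (simp only: quadratic poly_op_mult)
      then have "poly_op q f = 0"
        using \<open>b \<noteq> 0\<close> by (rule sum_squares_op_kernel(2)[OF poly_op_supported[OF less.prems(2)]])
      then show ?thesis
        using less.hyps[OF deg \<open>q \<noteq> 0\<close> less.prems(2)] by blast
    qed
  qed
qed

text \<open>The reverse inequality is \<open>sum_dim_E_le\<close>. This half is the one that needs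
  diagonalizability, and it makes the count of Dirichlet eigenvalues exhaustive.\<close>

lemma card_le_sum_dim_E: "card X \<le> (\<Sum>\<theta>\<in>point_spectrum. fun_space.dim (E \<theta>))"
proof -
  have "supported X \<subseteq> fun_space.span (\<Union>\<theta>. E \<theta>)"
  proof
    fix f assume f: "f \<in> supported X"
    obtain p where "p \<noteq> 0" "poly_op p f = 0"
      using f by (rule annihilating_poly)
    then show "f \<in> fun_space.span (\<Union>\<theta>. E \<theta>)"
      using f by (intro poly_op_kernel_subset_span)
  qed
  also have "\<dots> \<subseteq> fun_space.span (\<Union>\<theta>\<in>point_spectrum. E \<theta>)"
  proof (intro fun_space.span_minimal fun_space.subspace_span subsetI)
    fix f assume "f \<in> (\<Union>\<theta>. E \<theta>)"
    then obtain \<theta> where "f \<in> E \<theta>"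
      by blast
    show "f \<in> fun_space.span (\<Union>\<theta>\<in>point_spectrum. E \<theta>)"
    proof (cases "f = 0")
      case True
      then show ?thesis
        by (simp only: fun_space.span_zero)
    next
      case False
      then have "\<theta> \<in> point_spectrum"
        using \<open>f \<in> E \<theta>\<close> unfolding point_spectrum_def by blast
      then show ?thesis
        using \<open>f \<in> E \<theta>\<close> by (intro fun_space.span_base) blast
    qed
  qed
  finally have *: "supported X \<subseteq> fun_space.span (\<Union>\<theta>\<in>point_spectrum. E \<theta>)" .
  have "fun_space.span (\<Union>\<theta>\<in>point_spectrum. E \<theta>) \<subseteq> supported X"
    using subspace_supported by (intro fun_space.span_minimal) (auto simp: E_def)
  then show ?thesis
    using dim_le_of_supported[OF finite_X *] dim_supported[OF finite_X]
      dim_span_E[OF finite_point_spectrum] by simp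
qed

end

section \<open>Laplacians of glued graphs\<close>

lemma conductance_commute: "conductance H x y = conductance H y x"
proof -
  have "Upair x y = Upair y x"
    by simp
  then show ?thesis
    by (simp only: conductance_def)
qed

text \<open>One statement for two operators: the inner vertices as \<open>X\<close> give the
  Dirichlet Laplacian, all vertices give the Laplacian of a closed graph. A function supported in
  \<open>X\<close> lets the sum run over all vertices, where the conductance is symmetric.\<close>

lemma laplacian_symmetric_operator:
  assumes fin: "finite (verts H)" and X: "X \<subseteq> verts H"
  shows "symmetric_operator X (\<lambda>f x. if x \<in> X then laplacian H f x else 0)"
proof
  show "finite X"
    using fin X by (rule rev_finite_subset)
next
  fix f g :: "'a \<Rightarrow> real"
  assume f: "f \<in> supported X" and g: "g \<in> supported X"
  let ?V = "verts H" and ?c = "\<lambda>x y. real (conductance H x y)"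
  have expand: "(\<Sum>x\<in>X. laplacian H u x * v x)
      = (\<Sum>x\<in>?V. \<Sum>y\<in>?V. ?c x y * (u x * v x)) - (\<Sum>x\<in>?V. \<Sum>y\<in>?V. ?c x y * (u y * v x))"
    if "v \<in> supported X" for u v
  proof -
    have "(\<Sum>x\<in>X. laplacian H u x * v x) = (\<Sum>x\<in>?V. laplacian H u x * v x)"
      using that fin X by (intro sum.mono_neutral_left) (auto simp: supported_def)
    also have "\<dots> = (\<Sum>x\<in>?V. \<Sum>y\<in>?V. ?c x y * (u x * v x) - ?c x y * (u y * v x))"
      unfolding laplacian_def sum_distrib_right
      by (intro sum.cong refl) (simp add: algebra_simps)
    finally show ?thesis
      by (simp add: sum_subtractf)
  qed
  have "(\<Sum>x\<in>?V. \<Sum>y\<in>?V. ?c x y * (f y * g x)) = (\<Sum>x\<in>?V. \<Sum>y\<in>?V. ?c x y * (g y * f x))"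
    by (subst sum.swap, intro sum.cong refl) (simp add: conductance_commute mult_ac)
  then have "(\<Sum>x\<in>X. laplacian H f x * g x) = (\<Sum>x\<in>X. laplacian H g x * f x)"
    using expand[OF f] expand[OF g] by (simp add: mult.commute)
  then show "(\<Sum>x\<in>X. (if x \<in> X then laplacian H f x else 0) * g x)
      = (\<Sum>x\<in>X. f x * (if x \<in> X then laplacian H g x else 0))"
    by (simp add: mult.commute)
qed (auto simp: laplacian_def supported_def fun_eq_iff algebra_simps sum.distrib sum_distrib_left
    sum_subtractf)

text \<open>Sums over edges, unlike sums over vertices, are compatible with identifications of vertices.\<close>

definition edge_term :: "('v \<Rightarrow> real) \<Rightarrow> 'v \<Rightarrow> 'v uprod \<Rightarrow> real" where
  "edge_term f x e = (if x \<in> set_uprod e then \<Sum>y\<in>set_uprod e. f x - f y else 0)"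

definition edge_laplacian :: "'v uprod multiset \<Rightarrow> ('v \<Rightarrow> real) \<Rightarrow> 'v \<Rightarrow> real" where
  "edge_laplacian M f x = (\<Sum>e\<in>#M. edge_term f x e)"

definition wf_multigraph :: "('v, 'z) multigraph_scheme \<Rightarrow> bool" where
  "wf_multigraph H \<longleftrightarrow> finite (verts H) \<and> (\<forall>e\<in>#edges H. set_uprod e \<subseteq> verts H)"

text \<open>The two endpoints enter independently, so the formula survives their identification: for
  a loop both terms are 0.\<close>

lemma edge_term_Upair:
  "edge_term f x (Upair u v) = (if x = u then f u - f v else 0) + (if x = v then f v - f u else 0)"
  by (cases "u = v") (auto simp: edge_term_def)

lemma laplacian_eq_edge_laplacian:
  assumes "wf_multigraph H"
  shows "laplacian H f x = edge_laplacian (edges H) f x"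
proof -
  have "(\<Sum>y\<in>V. real (count M (Upair x y)) * (f x - f y)) = edge_laplacian M f x"
    if "finite V" "\<forall>e\<in>#M. set_uprod e \<subseteq> V" for V M
    using that(2)
  proof (induction M)
    case (add e M)
    obtain u v where e: "e = Upair u v"
      by (cases e)
    have uv: "u \<in> V" "v \<in> V"
      using add.prems e by auto
    have "(\<Sum>y\<in>V. if Upair u v = Upair x y then f x - f y else 0) = edge_term f x e"
    proof -
      consider "x = u" | "x = v" "x \<noteq> u" | "x \<noteq> u" "x \<noteq> v"
        by blast
      then show ?thesis
      proof cases
        case 1
        then have "(\<Sum>y\<in>V. if Upair u v = Upair x y then f x - f y else 0)
            = (\<Sum>y\<in>V. if y = v then f x - f y else 0)"
          by (intro sum.cong) auto
        then show ?thesis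
          using 1 uv that(1) by (auto simp: e edge_term_Upair)
      next
        case 2
        then have "(\<Sum>y\<in>V. if Upair u v = Upair x y then f x - f y else 0)
            = (\<Sum>y\<in>V. if y = u then f x - f y else 0)"
          by (intro sum.cong) auto
        then show ?thesis
          using 2 uv that(1) by (auto simp: e edge_term_Upair)
      next
        case 3
        then show ?thesis
          by (auto simp: e edge_term_Upair intro!: sum.neutral)
      qed
    qed
    moreover have "(\<Sum>y\<in>V. real (count (add_mset e M) (Upair x y)) * (f x - f y))
        = (\<Sum>y\<in>V. if Upair u v = Upair x y then f x - f y else 0)
          + (\<Sum>y\<in>V. real (count M (Upair x y)) * (f x - f y))"
      unfolding sum.distrib[symmetric] by (intro sum.cong) (auto simp: e algebra_simps)
    ultimately show ?case
      using add by (simp add: edge_laplacian_def)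
  qed (simp add: edge_laplacian_def)
  then show ?thesis
    using assms by (simp add: wf_multigraph_def laplacian_def conductance_def)
qed

lemma edge_laplacian_union: "edge_laplacian (M + N) f x = edge_laplacian M f x + edge_laplacian N f x"
  by (simp add: edge_laplacian_def)

text \<open>Kirchhoff's rule: an identified vertex collects the flows of all vertices merged into
  it, since every edge is kept, possibly as a loop or a parallel edge.\<close>

lemma edge_laplacian_map:
  assumes "wf_multigraph H"
  shows "edge_laplacian (image_mset (map_uprod g) (edges H)) f x
    = (\<Sum>z | z \<in> verts H \<and> g z = x. laplacian H (f \<circ> g) z)"
proof -
  have "edge_laplacian (image_mset (map_uprod g) M) f x
      = (\<Sum>z | z \<in> V \<and> g z = x. edge_laplacian M (f \<circ> g) z)"
    if V: "finite V" and M: "\<forall>e\<in>#M. set_uprod e \<subseteq> V" for V M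
    using M
  proof (induction M)
    case (add e M)
    obtain u v where e: "e = Upair u v"
      by (cases e)
    have uv: "u \<in> V" "v \<in> V"
      using add.prems e by auto
    let ?A = "{z. z \<in> V \<and> g z = x}"
    have "edge_term f x (map_uprod g e) = (\<Sum>z\<in>?A. edge_term (f \<circ> g) z e)"
      using V uv by (auto simp: e edge_term_Upair sum.distrib)
    then show ?case
      using add by (simp add: edge_laplacian_def sum.distrib comp_def)
  qed (simp add: edge_laplacian_def)
  then show ?thesis
    using assms by (simp add: wf_multigraph_def laplacian_eq_edge_laplacian[OF assms])
qed

lemma laplacian_cong:
  assumes "\<And>y. y \<in> verts H \<Longrightarrow> f y = g y" "x \<in> verts H"
  shows "laplacian H f x = laplacian H g x"
  using assms by (simp add: laplacian_def)

lemma glue_eq_iff [simp]: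
  "glue i S z = Copy j y \<longleftrightarrow> i = j \<and> z = y \<and> z \<notin> S"
  "glue i S z = Glued \<longleftrightarrow> z \<in> S"
  by (auto simp: glue_def)

lemma edge_laplacian_glue_Copy:
  assumes "wf_multigraph H"
  shows "edge_laplacian (glue_edges i S H) f (Copy j z)
    = (if i = j \<and> z \<in> verts H - S then laplacian H (f \<circ> glue i S) z else 0)"
proof -
  have "{y. y \<in> verts H \<and> glue i S y = Copy j z} = (if i = j \<and> z \<in> verts H - S then {z} else {})"
    by auto
  then show ?thesis
    by (simp add: edge_laplacian_map[OF assms])
qed

lemma edge_laplacian_glue_Glued:
  assumes "wf_multigraph H"
  shows "edge_laplacian (glue_edges i S H) f Glued
    = (\<Sum>z\<in>verts H \<inter> S. laplacian H (f \<circ> glue i S) z)"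
  by (simp add: edge_laplacian_map[OF assms] Int_def)

lemma glue_edges_subset:
  assumes "wf_multigraph H" "e \<in># glue_edges i S H"
  shows "set_uprod e \<subseteq> glue_verts i S H"
  using assms unfolding wf_multigraph_def by (fastforce simp: uprod.set_map)

section \<open>The recursive structure of the graphs\<close>

abbreviation left :: "nat \<Rightarrow> vertex" where "left n \<equiv> fst (ends (G n))"
abbreviation right :: "nat \<Rightarrow> vertex" where "right n \<equiv> snd (ends (G n))"
abbreviation inside :: "nat \<Rightarrow> vertex set" where "inside n \<equiv> verts (G n) - boundary (G n)"

lemma boundary_G: "boundary (G n) = {left n, right n}"
  by (simp add: boundary_def)

lemma G_wf:
  "wf_multigraph (G n) \<and> left n \<in> verts (G n) \<and> right n \<in> verts (G n) \<and> left n \<noteq> right n"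
proof (induction n rule: G.induct)
  case (3 n)
  let ?G = "G (Suc (Suc n))"
  note wf = "3.IH"(1)[THEN conjunct1] "3.IH"(2)[THEN conjunct1]
  have "finite (verts ?G)"
    using wf by (simp add: Let_def wf_multigraph_def)
  moreover have "\<forall>e\<in>#edges ?G. set_uprod e \<subseteq> verts ?G"
    using glue_edges_subset[OF wf(1)] glue_edges_subset[OF wf(2)]
    by (simp add: Let_def) blast
  moreover have "Copy i (right n) \<in> glue_verts i {left n} (G n)" for i
    using 3 by (intro image_eqI[of _ _ "right n"]) (auto simp: glue_def)
  ultimately show ?case
    by (simp add: Let_def wf_multigraph_def)
qed (auto simp: wf_multigraph_def)

lemma wf_G: "wf_multigraph (G n)" and left_verts [simp]: "left n \<in> verts (G n)"
  and right_verts [simp]: "right n \<in> verts (G n)" and left_neq_right [simp]: "left n \<noteq> right n" "right n \<noteq> left n"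
  using G_wf[of n] by auto

lemma finite_verts_G [simp]: "finite (verts (G n))"
  using wf_G[of n] by (simp add: wf_multigraph_def)

lemma ends_G_step: "left (Suc (Suc n)) = Copy 1 (right n)" "right (Suc (Suc n)) = Copy 2 (right n)"
  by (simp_all add: Let_def)

lemma glue_verts_boundary:
  "glue_verts i (boundary (G n)) (G n) = insert Glued (Copy i ` inside n)"
  by (auto simp: glue_def boundary_G image_iff split: if_splits) (metis left_verts)

lemma glue_verts_left:
  "glue_verts i {left n} (G n) = {Glued, Copy i (right n)} \<union> Copy i ` inside n"
  by (auto simp: glue_def boundary_G image_iff split: if_splits)

lemma verts_G_step:
  "verts (G (Suc (Suc n))) = {Glued, Copy 1 (right n), Copy 2 (right n)} \<union> Copy 0 ` inside (Suc n)
    \<union> Copy 1 ` inside n \<union> Copy 2 ` inside n"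
proof -
  have "verts (G (Suc (Suc n))) = glue_verts 0 (boundary (G (Suc n))) (G (Suc n))
      \<union> glue_verts 1 {left n} (G n) \<union> glue_verts 2 {left n} (G n)"
    by (simp add: Let_def)
  then show ?thesis
    unfolding glue_verts_boundary glue_verts_left by auto
qed

lemma inside_G_step:
  "inside (Suc (Suc n))
    = {Glued} \<union> Copy 0 ` inside (Suc n) \<union> Copy 1 ` inside n \<union> Copy 2 ` inside n"
  unfolding verts_G_step boundary_G ends_G_step by (auto simp: boundary_G)

lemma verts_\<Gamma>_Suc:
  "verts (\<Gamma> (Suc n)) = {Glued} \<union> Copy 0 ` inside (Suc n) \<union> Copy 1 ` inside n"
proof -
  have "verts (\<Gamma> (Suc n)) = glue_verts 0 (boundary (G (Suc n))) (G (Suc n))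
      \<union> glue_verts 1 (boundary (G n)) (G n)"
    by (simp add: Let_def)
  then show ?thesis
    unfolding glue_verts_boundary by auto
qed

section \<open>Numbers of vertices\<close>

lemma card_Copy: "card (Copy i ` A) = card A"
  by (intro card_image) (simp add: inj_on_def)

lemma Copy_disjoint: "i \<noteq> j \<Longrightarrow> Copy i ` A \<inter> Copy j ` B = {}"
  by auto

lemma card_inside_step: "card (inside (Suc (Suc n))) = 1 + card (inside (Suc n)) + 2 * card (inside n)"
  unfolding inside_G_step
  by (simp add: card_Un_disjoint card_Copy Copy_disjoint Int_Un_distrib2 image_iff)

lemma card_inside_0: "card (inside 0) = 0" and card_inside_1: "card (inside (Suc 0)) = 1"
proof -
  have "inside 0 = {}" "inside (Suc 0) = {Base 1}"
    by (auto simp: boundary_def)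
  then show "card (inside 0) = 0" "card (inside (Suc 0)) = 1"
    by (simp_all only: card.empty card_1_singleton_iff) simp_all
qed

text \<open>The recursion makes this quantity, the number of vertices of
  \<open>\<Gamma> (Suc n)\<close>, double at each step.\<close>

lemma card_inside_pair: "card (inside (Suc n)) + card (inside n) + 1 = 2 ^ Suc n"
proof (induction n)
  case (Suc n)
  then show ?case
    unfolding card_inside_step by simp
qed (use card_inside_0 card_inside_1 in simp)

lemma card_verts_\<Gamma>: "card (verts (\<Gamma> n)) = 2 ^ n"
proof (cases n)
  case (Suc m)
  have "card (verts (\<Gamma> (Suc m))) = 1 + card (inside (Suc m)) + card (inside m)"
    unfolding verts_\<Gamma>_Suc by (simp add: card_Un_disjoint card_Copy Copy_disjoint image_iff)
  then show ?thesis
    using card_inside_pair[of m] Suc by simp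
qed simp

text \<open>The second and third claims include z = \<open>right n\<close>, the vertex that becomes
  an end: its flow is that of its own copy alone.\<close>

lemma laplacian_G_step:
  fixes f n
  defines "f0 \<equiv> f \<circ> glue 0 (boundary (G (Suc n)))"
    and "f1 \<equiv> f \<circ> glue 1 {left n}" and "f2 \<equiv> f \<circ> glue 2 {left n}"
  shows "z \<in> inside (Suc n) \<Longrightarrow> laplacian (G (Suc (Suc n))) f (Copy 0 z) = laplacian (G (Suc n)) f0 z"
    and "z \<in> verts (G n) \<Longrightarrow> z \<noteq> left n \<Longrightarrow>
      laplacian (G (Suc (Suc n))) f (Copy 1 z) = laplacian (G n) f1 z"
    and "z \<in> verts (G n) \<Longrightarrow> z \<noteq> left n \<Longrightarrow>
      laplacian (G (Suc (Suc n))) f (Copy 2 z) = laplacian (G n) f2 z"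
    and "laplacian (G (Suc (Suc n))) f Glued
      = laplacian (G (Suc n)) f0 (left (Suc n)) + laplacian (G (Suc n)) f0 (right (Suc n))
        + laplacian (G n) f1 (left n) + laplacian (G n) f2 (left n)"
proof -
  have e: "edges (G (Suc (Suc n))) = glue_edges 0 (boundary (G (Suc n))) (G (Suc n))
      + glue_edges 1 {left n} (G n) + glue_edges 2 {left n} (G n)"
    by (simp add: Let_def)
  have l: "laplacian (G (Suc (Suc n))) f x = edge_laplacian (glue_edges 0 (boundary (G (Suc n))) (G (Suc n))) f x
      + edge_laplacian (glue_edges 1 {left n} (G n)) f x + edge_laplacian (glue_edges 2 {left n} (G n)) f x" for x
    by (simp only: laplacian_eq_edge_laplacian[OF wf_G] e edge_laplacian_union)
  show "z \<in> inside (Suc n) \<Longrightarrow> laplacian (G (Suc (Suc n))) f (Copy 0 z) = laplacian (G (Suc n)) f0 z"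
    and "z \<in> verts (G n) \<Longrightarrow> z \<noteq> left n \<Longrightarrow>
      laplacian (G (Suc (Suc n))) f (Copy 1 z) = laplacian (G n) f1 z"
    and "z \<in> verts (G n) \<Longrightarrow> z \<noteq> left n \<Longrightarrow>
      laplacian (G (Suc (Suc n))) f (Copy 2 z) = laplacian (G n) f2 z"
    unfolding l edge_laplacian_glue_Copy[OF wf_G] by (simp_all add: f0_def f1_def f2_def)
  have "verts (G (Suc n)) \<inter> boundary (G (Suc n)) = {left (Suc n), right (Suc n)}" "verts (G n) \<inter> {left n} = {left n}"
    by (auto simp: boundary_G)
  then show "laplacian (G (Suc (Suc n))) f Glued
      = laplacian (G (Suc n)) f0 (left (Suc n)) + laplacian (G (Suc n)) f0 (right (Suc n))
        + laplacian (G n) f1 (left n) + laplacian (G n) f2 (left n)"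
    unfolding l edge_laplacian_glue_Glued[OF wf_G] by (simp add: f0_def f1_def f2_def)
qed

lemma wf_\<Gamma>: "wf_multigraph (\<Gamma> n)"
proof (cases n)
  case (Suc m)
  have "finite (verts (\<Gamma> (Suc m)))"
    unfolding verts_\<Gamma>_Suc by simp
  moreover have "\<forall>e\<in>#edges (\<Gamma> (Suc m)). set_uprod e \<subseteq> verts (\<Gamma> (Suc m))"
    using glue_edges_subset[OF wf_G[of m]] glue_edges_subset[OF wf_G[of "Suc m"]]
    by (simp add: Let_def) blast
  ultimately show ?thesis
    using Suc by (simp add: wf_multigraph_def)
qed (simp add: wf_multigraph_def)

lemma laplacian_\<Gamma>_Suc:
  "z \<in> inside (Suc n) \<Longrightarrow> laplacian (\<Gamma> (Suc n)) f (Copy 0 z)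
    = laplacian (G (Suc n)) (f \<circ> glue 0 (boundary (G (Suc n)))) z"
  "z \<in> inside n \<Longrightarrow> laplacian (\<Gamma> (Suc n)) f (Copy 1 z)
    = laplacian (G n) (f \<circ> glue 1 (boundary (G n))) z"
proof -
  have e: "edges (\<Gamma> (Suc n)) = glue_edges 0 (boundary (G (Suc n))) (G (Suc n))
      + glue_edges 1 (boundary (G n)) (G n)"
    by (simp add: Let_def)
  have l: "laplacian (\<Gamma> (Suc n)) f x = edge_laplacian (glue_edges 0 (boundary (G (Suc n))) (G (Suc n))) f x
      + edge_laplacian (glue_edges 1 (boundary (G n)) (G n)) f x" for x
    by (simp only: laplacian_eq_edge_laplacian[OF wf_\<Gamma>] e edge_laplacian_union)
  show "z \<in> inside (Suc n) \<Longrightarrow> laplacian (\<Gamma> (Suc n)) f (Copy 0 z)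
    = laplacian (G (Suc n)) (f \<circ> glue 0 (boundary (G (Suc n)))) z"
    and "z \<in> inside n \<Longrightarrow> laplacian (\<Gamma> (Suc n)) f (Copy 1 z)
    = laplacian (G n) (f \<circ> glue 1 (boundary (G n))) z"
    unfolding l edge_laplacian_glue_Copy[OF wf_G] by simp_all
qed

declare G.simps(3) [simp del] \<Gamma>.simps(2) [simp del]

section \<open>Cauchy data of solutions\<close>

lemma laplacian_add: "laplacian H (f + g) x = laplacian H f x + laplacian H g x"
  unfolding laplacian_def sum.distrib[symmetric] by (simp add: algebra_simps)

lemma laplacian_scale: "laplacian H (\<lambda>x. c * f x) x = c * laplacian H f x"
  by (simp add: laplacian_def sum_distrib_left algebra_simps)

text \<open>Nothing is required off the vertex set or at the ends, so that restrictions
  \<open>f \<circ> glue i S\<close> to a copy are again solutions without correction.\<close>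

definition solutions :: "nat \<Rightarrow> real \<Rightarrow> (vertex \<Rightarrow> real) set" where
  "solutions n \<theta> = {f. \<forall>x\<in>inside n. laplacian (G n) f x = \<theta> * f x}"

definition cauchy_data :: "nat \<Rightarrow> real \<Rightarrow> (real \<times> real \<times> real \<times> real) set" where
  "cauchy_data n \<theta> = (\<lambda>f. (f (left n), f (right n),
    laplacian (G n) f (left n), laplacian (G n) f (right n))) ` solutions n \<theta>"

abbreviation Dir :: "nat \<Rightarrow> real \<Rightarrow> (vertex \<Rightarrow> real) set" where
  "Dir n \<equiv> dirichlet_eigenspace (G n)"

lemma Dir_iff: "f \<in> Dir n \<theta> \<longleftrightarrow> f \<in> supported (inside n) \<and> f \<in> solutions n \<theta>"
  by (auto simp: dirichlet_eigenspace_def supported_def solutions_def)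

lemma solutions_cong:
  assumes "\<And>x. x \<in> verts (G n) \<Longrightarrow> f x = g x"
  shows "f \<in> solutions n \<theta> \<longleftrightarrow> g \<in> solutions n \<theta>"
proof -
  have "laplacian (G n) f x = laplacian (G n) g x" if "x \<in> verts (G n)" for x
    using assms that by (rule laplacian_cong)
  then show ?thesis
    using assms by (auto simp: solutions_def)
qed

lemma solutions_step:
  "f \<in> solutions (Suc (Suc n)) \<theta> \<longleftrightarrow>
    f \<circ> glue 0 (boundary (G (Suc n))) \<in> solutions (Suc n) \<theta> \<and>
    f \<circ> glue 1 {left n} \<in> solutions n \<theta> \<and> f \<circ> glue 2 {left n} \<in> solutions n \<theta> \<and>
    laplacian (G (Suc (Suc n))) f Glued = \<theta> * f Glued"
proof -
  have g: "(f \<circ> glue i S) z = f (Copy i z)" if "z \<notin> S" for i S z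
    using that by (simp add: glue_def)
  have "(\<forall>x\<in>Copy 0 ` inside (Suc n). laplacian (G (Suc (Suc n))) f x = \<theta> * f x) \<longleftrightarrow>
      f \<circ> glue 0 (boundary (G (Suc n))) \<in> solutions (Suc n) \<theta>"
    using laplacian_G_step(1)[of _ n f] g[of _ "boundary (G (Suc n))" 0] by (auto simp: solutions_def)
  moreover have "(\<forall>x\<in>Copy 1 ` inside n. laplacian (G (Suc (Suc n))) f x = \<theta> * f x) \<longleftrightarrow>
      f \<circ> glue 1 {left n} \<in> solutions n \<theta>"
    using laplacian_G_step(2)[of _ n f] g[of _ "{left n}" 1] by (auto simp: solutions_def boundary_G)
  moreover have "(\<forall>x\<in>Copy 2 ` inside n. laplacian (G (Suc (Suc n))) f x = \<theta> * f x) \<longleftrightarrow>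
      f \<circ> glue 2 {left n} \<in> solutions n \<theta>"
    using laplacian_G_step(3)[of _ n f] g[of _ "{left n}" 2] by (auto simp: solutions_def boundary_G)
  ultimately show ?thesis
    unfolding solutions_def[of "Suc (Suc n)"] inside_G_step by auto
qed

text \<open>Stated for a given solution rather than for its data alone, because the value
  \<open>f Glued\<close> of a Dirichlet eigenfunction has to be controlled later.\<close>

lemma cauchy_data_of_solution:
  assumes f: "f \<in> solutions (Suc (Suc n)) \<theta>"
  obtains x y c d where "(f Glued, f Glued, x, y) \<in> cauchy_data (Suc n) \<theta>"
    "(f Glued, f (Copy 1 (right n)), c, laplacian (G (Suc (Suc n))) f (Copy 1 (right n)))
      \<in> cauchy_data n \<theta>"
    "(f Glued, f (Copy 2 (right n)), d, laplacian (G (Suc (Suc n))) f (Copy 2 (right n)))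
      \<in> cauchy_data n \<theta>"
    "x + y + c + d = \<theta> * f Glued"
proof -
  let ?f0 = "f \<circ> glue 0 (boundary (G (Suc n)))"
    and ?f1 = "f \<circ> glue 1 {left n}" and ?f2 = "f \<circ> glue 2 {left n}"
  have v: "?f0 (left (Suc n)) = f Glued" "?f0 (right (Suc n)) = f Glued"
    "?f1 (left n) = f Glued" "?f2 (left n) = f Glued"
    "?f1 (right n) = f (Copy 1 (right n))" "?f2 (right n) = f (Copy 2 (right n))"
    by (auto simp: glue_def boundary_G)
  have l: "laplacian (G (Suc (Suc n))) f (Copy 1 (right n)) = laplacian (G n) ?f1 (right n)"
    "laplacian (G (Suc (Suc n))) f (Copy 2 (right n)) = laplacian (G n) ?f2 (right n)"
    by (simp_all only: laplacian_G_step(2,3)[OF right_verts left_neq_right(2)])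
  have "(f Glued, f Glued, laplacian (G (Suc n)) ?f0 (left (Suc n)),
      laplacian (G (Suc n)) ?f0 (right (Suc n))) \<in> cauchy_data (Suc n) \<theta>"
    unfolding cauchy_data_def by (rule image_eqI[of _ _ ?f0]) (use f solutions_step v in simp_all)
  moreover have "(f Glued, f (Copy 1 (right n)), laplacian (G n) ?f1 (left n),
      laplacian (G (Suc (Suc n))) f (Copy 1 (right n))) \<in> cauchy_data n \<theta>"
    unfolding cauchy_data_def l
    by (rule image_eqI[of _ _ ?f1]) (use f solutions_step[of f n \<theta>] v in simp_all)
  moreover have "(f Glued, f (Copy 2 (right n)), laplacian (G n) ?f2 (left n),
      laplacian (G (Suc (Suc n))) f (Copy 2 (right n))) \<in> cauchy_data n \<theta>"
    unfolding cauchy_data_def l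
    by (rule image_eqI[of _ _ ?f2]) (use f solutions_step[of f n \<theta>] v in simp_all)
  moreover have "laplacian (G (Suc n)) ?f0 (left (Suc n)) + laplacian (G (Suc n)) ?f0 (right (Suc n))
      + laplacian (G n) ?f1 (left n) + laplacian (G n) ?f2 (left n) = \<theta> * f Glued"
    using f solutions_step[of f n \<theta>] laplacian_G_step(4)[of n f] by simp
  ultimately show ?thesis
    by (rule that)
qed

text \<open>The gluing rule on which all shape computations rest. Here \<open>t\<close> is the value
  at the glued vertex, \<open>x\<close> and \<open>y\<close> are the flows there at the two ends of
  \<open>G (Suc n)\<close>, and \<open>c\<close> and \<open>d\<close> those of the two copies of
  \<open>G n\<close>, whose free ends carry (p, w) and (q, u).\<close>

lemma cauchy_data_step:
  "(p, q, w, u) \<in> cauchy_data (Suc (Suc n)) \<theta> \<longleftrightarrow>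
    (\<exists>t x y c d. (t, t, x, y) \<in> cauchy_data (Suc n) \<theta> \<and> (t, p, c, w) \<in> cauchy_data n \<theta> \<and>
      (t, q, d, u) \<in> cauchy_data n \<theta> \<and> x + y + c + d = \<theta> * t)" (is "?L \<longleftrightarrow> ?R")
proof
  assume ?L
  then obtain f where f: "f \<in> solutions (Suc (Suc n)) \<theta>"
    and e: "p = f (Copy 1 (right n))" "q = f (Copy 2 (right n))"
      "w = laplacian (G (Suc (Suc n))) f (Copy 1 (right n))"
      "u = laplacian (G (Suc (Suc n))) f (Copy 2 (right n))"
    by (auto simp: cauchy_data_def ends_G_step)
  from f show ?R
    unfolding e by (rule cauchy_data_of_solution) blast
next
  assume ?R
  then obtain f0 f1 f2 where f: "f0 \<in> solutions (Suc n) \<theta>" "f1 \<in> solutions n \<theta>" "f2 \<in> solutions n \<theta>"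
    and v: "f0 (left (Suc n)) = f0 (right (Suc n))" "f1 (left n) = f0 (right (Suc n))"
      "f2 (left n) = f0 (right (Suc n))" "p = f1 (right n)" "q = f2 (right n)"
      "w = laplacian (G n) f1 (right n)" "u = laplacian (G n) f2 (right n)"
    and sum: "laplacian (G (Suc n)) f0 (left (Suc n)) + laplacian (G (Suc n)) f0 (right (Suc n))
      + laplacian (G n) f1 (left n) + laplacian (G n) f2 (left n) = \<theta> * f0 (right (Suc n))"
    unfolding cauchy_data_def by auto
  define f where "f = (\<lambda>v. case v of Glued \<Rightarrow> f0 (right (Suc n))
    | Copy i z \<Rightarrow> if i = 0 then f0 z else if i = 1 then f1 z else f2 z | Base k \<Rightarrow> 0)"
  have e: "f \<circ> glue 0 (boundary (G (Suc n))) = f0" "f \<circ> glue 1 {left n} = f1" "f \<circ> glue 2 {left n} = f2"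
    using v by (auto simp: f_def glue_def boundary_G fun_eq_iff)
  have "f \<in> solutions (Suc (Suc n)) \<theta>"
    unfolding solutions_step e laplacian_G_step(4) using f sum by (simp add: f_def)
  moreover have "laplacian (G (Suc (Suc n))) f (Copy 1 (right n)) = w"
    "laplacian (G (Suc (Suc n))) f (Copy 2 (right n)) = u"
    using laplacian_G_step(2,3)[of "right n" n f] unfolding e v by simp_all
  ultimately show ?L
    unfolding cauchy_data_def ends_G_step using v by (intro image_eqI[of _ _ f]) (auto simp: f_def)
qed

lemma dirichlet_cauchy_data:
  "(0, 0, w, u) \<in> cauchy_data n \<theta> \<longleftrightarrow>
    (\<exists>f\<in>Dir n \<theta>. laplacian (G n) f (left n) = w \<and> laplacian (G n) f (right n) = u)" (is "?L \<longleftrightarrow> ?R")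
proof
  assume ?L
  then obtain f where f: "f \<in> solutions n \<theta>" "f (left n) = 0" "f (right n) = 0"
    "laplacian (G n) f (left n) = w" "laplacian (G n) f (right n) = u"
    by (auto simp: cauchy_data_def)
  \<comment> \<open>Solutions may be nonzero off the graph, whereas members of \<open>Dir\<close>
    may not; truncation changes no value on a vertex.\<close>
  define g where "g = (\<lambda>x. if x \<in> inside n then f x else 0)"
  have eq: "g x = f x" if "x \<in> verts (G n)" for x
    using that f by (auto simp: g_def boundary_G)
  then have "g \<in> Dir n \<theta>"
    using f(1) solutions_cong[of n g f] by (simp add: Dir_iff) (simp add: supported_def g_def)
  moreover have "laplacian (G n) g x = laplacian (G n) f x" if "x \<in> verts (G n)" for x
    using eq that by (rule laplacian_cong)
  from this[OF left_verts] this[OF right_verts]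
  have "laplacian (G n) g (left n) = w" "laplacian (G n) g (right n) = u"
    using f by simp_all
  ultimately show ?R
    by blast
next
  assume ?R
  then obtain f where f: "f \<in> Dir n \<theta>" "laplacian (G n) f (left n) = w" "laplacian (G n) f (right n) = u"
    by blast
  then have "f (left n) = 0" "f (right n) = 0"
    by (auto simp: Dir_iff supported_def boundary_G)
  then show ?L
    unfolding cauchy_data_def using f by (intro image_eqI[of _ _ f]) (auto simp: Dir_iff)
qed

section \<open>Dirichlet eigenspaces\<close>

global_interpretation dir: symmetric_operator "inside n"
  "\<lambda>f x. if x \<in> inside n then laplacian (G n) f x else 0" for n
  by (rule laplacian_symmetric_operator) auto

global_interpretation gam: symmetric_operator "verts (\<Gamma> n)"
  "\<lambda>f x. if x \<in> verts (\<Gamma> n) then laplacian (\<Gamma> n) f x else 0" for n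
  by (rule laplacian_symmetric_operator) (use wf_\<Gamma>[of n] in \<open>auto simp: wf_multigraph_def\<close>)

lemma dir_E: "dir.E n \<theta> = Dir n \<theta>"
  unfolding dir.E_def by (auto simp: Dir_iff supported_def solutions_def fun_eq_iff)

lemma gam_E: "gam.E n \<theta> = eigenspace (\<Gamma> n) \<theta>"
  unfolding gam.E_def by (auto simp: eigenspace_def supported_def fun_eq_iff)

lemma dir_point_spectrum: "dir.point_spectrum n = dirichlet_spectrum (G n)"
  unfolding dir.point_spectrum_def dir_E dirichlet_spectrum_def by (simp add: zero_fun_def)

lemma gam_point_spectrum: "gam.point_spectrum n = spectrum (\<Gamma> n)"
  unfolding gam.point_spectrum_def gam_E spectrum_def by (simp add: zero_fun_def)

lemma subspace_Dir: "fun_space.subspace (Dir n \<theta>)"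
  using dir.subspace_E[of n \<theta>] by (simp only: dir_E)

section \<open>Extension by zero from the glued pieces\<close>

definition embed :: "nat \<Rightarrow> (vertex \<Rightarrow> real) \<Rightarrow> vertex \<Rightarrow> real" where
  "embed i f v = (case v of Copy j z \<Rightarrow> if j = i then f z else 0 | _ \<Rightarrow> 0)"

lemma embed_simps [simp]:
  "embed i f (Copy j z) = (if j = i then f z else 0)" "embed i f Glued = 0" "embed i f (Base k) = 0"
  by (simp_all add: embed_def)

lemma linear_embed:
  "Vector_Spaces.linear (\<lambda>(c :: real) f x. c * f x) (\<lambda>(c :: real) f x. c * f x) (embed i)"
  unfolding Vector_Spaces.linear_iff
  by (auto simp: fun_space.vector_space_axioms fun_eq_iff embed_def split: vertex.split)

lemma inj_embed: "inj (embed i)"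
proof (rule injI)
  fix f g assume "embed i f = embed i g"
  then have "embed i f (Copy i z) = embed i g (Copy i z)" for z
    by simp
  then show "f = g"
    by (simp add: fun_eq_iff)
qed

lemma dim_embed: "fun_space.dim (embed i ` V) = fun_space.dim V"
  by (rule fun_space_pair.dim_injective_image[OF linear_embed inj_embed])

lemma subspace_embed: "fun_space.subspace V \<Longrightarrow> fun_space.subspace (embed i ` V)"
  by (rule fun_space_pair.linear_subspace_image[OF linear_embed])

lemma vertex_fun_eqI:
  assumes "\<And>k. f (Base k) = g (Base k)" "f Glued = g Glued" "\<And>i z. f (Copy i z) = g (Copy i z)"
  shows "f = g"
proof
  fix v show "f v = g v"
    using assms by (cases v) auto
qed

lemma mem_inside_G_step:
  "Copy i z \<in> inside (Suc (Suc n)) \<longleftrightarrow>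
    i = 0 \<and> z \<in> inside (Suc n) \<or> (i = 1 \<or> i = 2) \<and> z \<in> inside n"
  "Glued \<in> inside (Suc (Suc n))" "Base k \<notin> inside (Suc (Suc n))"
  unfolding inside_G_step by auto

text \<open>Vanishing at the glued vertex makes the restriction to each piece a Dirichlet
  eigenfunction. Conversely, a triple of these, extended by zero, solves every equation except
  possibly the balance of flows at the glued vertex.\<close>

lemma Dir_step_vanishing:
  fixes n \<theta>
  defines "W \<equiv> {x + y |x y. x \<in> {x + y |x y. x \<in> embed 0 ` Dir (Suc n) \<theta> \<and> y \<in> embed 1 ` Dir n \<theta>}
      \<and> y \<in> embed 2 ` Dir n \<theta>}"
  shows "{f \<in> Dir (Suc (Suc n)) \<theta>. f Glued = 0} = {f \<in> W. laplacian (G (Suc (Suc n))) f Glued = 0}"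
proof (intro equalityI subsetI)
  fix f assume "f \<in> {f \<in> Dir (Suc (Suc n)) \<theta>. f Glued = 0}"
  then have f: "f \<in> supported (inside (Suc (Suc n)))" "f \<in> solutions (Suc (Suc n)) \<theta>" "f Glued = 0"
    by (auto simp: Dir_iff)
  define g where "g i = (\<lambda>z. f (Copy i z))" for i
  have f0: "f v = 0" if "v \<notin> inside (Suc (Suc n))" for v
    using f(1) that by (simp add: supported_def)
  have 0: "g 0 z = 0" if "z \<notin> inside (Suc n)" for z
    unfolding g_def by (rule f0) (use that in \<open>simp add: mem_inside_G_step(1) del: Diff_iff\<close>)
  have 1: "g 1 z = 0" "g 2 z = 0" if "z \<notin> inside n" for z
    unfolding g_def by (rule f0; use that in \<open>simp add: mem_inside_G_step(1) del: Diff_iff\<close>)+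
  have eq: "f \<circ> glue 0 (boundary (G (Suc n))) = g 0" "f \<circ> glue 1 {left n} = g 1"
    "f \<circ> glue 2 {left n} = g 2"
  proof -
    have "f (glue i S z) = g i z" if "z \<in> S \<Longrightarrow> g i z = 0" for i S z
      using that f(3) by (auto simp: glue_def g_def)
    then have gl: "f \<circ> glue i S = g i" if "\<And>z. z \<in> S \<Longrightarrow> g i z = 0" for i S
      using that by (simp add: fun_eq_iff)
    show "f \<circ> glue 0 (boundary (G (Suc n))) = g 0"
      by (intro gl 0) simp
    show "f \<circ> glue 1 {left n} = g 1" "f \<circ> glue 2 {left n} = g 2"
      by (intro gl 1, simp add: boundary_G)+
  qed
  then have "g 0 \<in> Dir (Suc n) \<theta>" "g 1 \<in> Dir n \<theta>" "g 2 \<in> Dir n \<theta>"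
    using f(2) 0 1 unfolding solutions_step by (auto simp: Dir_iff supported_def)
  moreover have "f = embed 0 (g 0) + embed 1 (g 1) + embed 2 (g 2)"
  proof (rule vertex_fun_eqI)
    show "f (Base k) = (embed 0 (g 0) + embed 1 (g 1) + embed 2 (g 2)) (Base k)" for k
      using f0[OF mem_inside_G_step(3)] by simp
    show "f (Copy i z) = (embed 0 (g 0) + embed 1 (g 1) + embed 2 (g 2)) (Copy i z)" for i z
    proof -
      consider "i = 0" | "i = 1" | "i = 2" | "i \<noteq> 0" "i \<noteq> 1" "i \<noteq> 2"
        by blast
      then show ?thesis
      proof cases
        case 4
        then have "f (Copy i z) = 0"
          by (intro f0) (simp add: mem_inside_G_step(1) del: Diff_iff)
        then show ?thesis
          using 4 by simp
      qed (simp_all add: g_def)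
    qed
  qed (use f(3) in simp)
  ultimately have "f \<in> W"
    unfolding W_def by blast
  moreover have "laplacian (G (Suc (Suc n))) f Glued = 0"
    using f(2,3) unfolding solutions_step by simp
  ultimately show "f \<in> {f \<in> W. laplacian (G (Suc (Suc n))) f Glued = 0}"
    by simp
next
  fix f assume f: "f \<in> {f \<in> W. laplacian (G (Suc (Suc n))) f Glued = 0}"
  then obtain g0 g1 g2 where g: "g0 \<in> Dir (Suc n) \<theta>" "g1 \<in> Dir n \<theta>" "g2 \<in> Dir n \<theta>"
    and f_eq: "f = embed 0 g0 + embed 1 g1 + embed 2 g2"
    unfolding W_def by auto
  have eq: "f \<circ> glue 0 (boundary (G (Suc n))) = g0" "f \<circ> glue 1 {left n} = g1" "f \<circ> glue 2 {left n} = g2"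
    using g by (auto simp: f_eq fun_eq_iff glue_def Dir_iff supported_def boundary_G)
  have "f \<in> supported (inside (Suc (Suc n)))"
    unfolding supported_def
  proof (intro CollectI allI impI)
    fix v
    assume "v \<notin> inside (Suc (Suc n))"
    then show "f v = 0"
      using g by (cases v) (auto simp: f_eq Dir_iff supported_def mem_inside_G_step simp del: Diff_iff)
  qed
  moreover have "f \<in> solutions (Suc (Suc n)) \<theta>"
    unfolding solutions_step eq using g f by (auto simp: Dir_iff f_eq)
  ultimately show "f \<in> {f \<in> Dir (Suc (Suc n)) \<theta>. f Glued = 0}"
    by (simp add: Dir_iff f_eq)
qed

lemma finite_verts_\<Gamma>: "finite (verts (\<Gamma> n))"
  using wf_\<Gamma>[of n] by (simp add: wf_multigraph_def)

lemma embed_supported: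
  "f \<in> supported A \<Longrightarrow> Copy i ` A \<subseteq> B \<Longrightarrow> embed i f \<in> supported B"
  by (auto simp: supported_def embed_def split: vertex.split)

lemma embed_Int:
  assumes "i \<noteq> j"
  shows "embed i ` V \<inter> embed j ` W \<subseteq> {0}"
proof
  fix f assume "f \<in> embed i ` V \<inter> embed j ` W"
  then obtain g h where f: "f = embed i g" "f = embed j h"
    by blast
  have "f v = 0" for v
  proof (cases "\<exists>z. v = Copy i z")
    case True
    then show ?thesis
      using assms f(2) by auto
  next
    case False
    then show ?thesis
      using f(1) by (cases v) auto
  qed
  then show "f \<in> {0}"
    by (simp add: fun_eq_iff)
qed

lemma sums_supported:
  assumes "V \<subseteq> supported X" "W \<subseteq> supported X"
  shows "{x + y |x y. x \<in> V \<and> y \<in> W} \<subseteq> supported X"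
proof clarify
  fix x y assume "x \<in> V" "y \<in> W"
  then have "x \<in> supported X" "y \<in> supported X"
    using assms by auto
  then show "x + y \<in> supported X"
    by (simp add: supported_def)
qed

text \<open>By \<open>Dir_step_vanishing\<close> the eigenspace is cut out of the space of triples
  by one linear condition. Whether it is trivial is visible in the data with zero boundary values:
  both flows of \<open>G (Suc n)\<close> meet the glued vertex, but only the left flow of each copy
  of \<open>G n\<close>.\<close>

lemma dim_Dir_step:
  assumes "\<And>f. f \<in> Dir (Suc (Suc n)) \<theta> \<Longrightarrow> f Glued = 0"
  shows "fun_space.dim (Dir (Suc n) \<theta>) + 2 * fun_space.dim (Dir n \<theta>)
    = fun_space.dim (Dir (Suc (Suc n)) \<theta>)
      + (if (\<forall>x y. (0, 0, x, y) \<in> cauchy_data (Suc n) \<theta> \<longrightarrow> x + y = 0)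
          \<and> (\<forall>w u. (0, 0, w, u) \<in> cauchy_data n \<theta> \<longrightarrow> w = 0) then 0 else 1)"
proof -
  let ?X = "inside (Suc (Suc n))"
  let ?V0 = "embed 0 ` Dir (Suc n) \<theta>" and ?V1 = "embed 1 ` Dir n \<theta>" and ?V2 = "embed 2 ` Dir n \<theta>"
  let ?U = "{x + y |x y. x \<in> ?V0 \<and> y \<in> ?V1}"
  let ?W = "{x + y |x y. x \<in> ?U \<and> y \<in> ?V2}"
  let ?T = "(\<lambda>x. indicator {x} :: vertex \<Rightarrow> real) ` ?X"
  let ?\<Phi> = "\<lambda>f. laplacian (G (Suc (Suc n))) f Glued"
  have finT: "finite ?T"
    by simp
  have V: "?V0 \<subseteq> supported ?X" "?V1 \<subseteq> supported ?X" "?V2 \<subseteq> supported ?X"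
    unfolding inside_G_step by (auto simp: Dir_iff intro!: embed_supported)
  have span: "supported ?X \<subseteq> fun_space.span ?T"
    by (rule supported_subset_span) simp
  have sub: "fun_space.subspace ?V0" "fun_space.subspace ?V1" "fun_space.subspace ?V2"
    by (intro subspace_embed subspace_Dir)+
  have sub01: "fun_space.subspace ?U"
    using sub(1,2) by (rule fun_space.subspace_sums)
  have subW: "fun_space.subspace ?W"
    using sub01 sub(3) by (rule fun_space.subspace_sums)
  have U: "?U \<subseteq> supported ?X"
    by (rule sums_supported[OF V(1,2)])
  then have W: "?W \<subseteq> supported ?X"
    using V(3) by (rule sums_supported)
  have int1: "?V0 \<inter> ?V1 \<subseteq> {0}"
    by (rule embed_Int) simp
  have int2: "?U \<inter> ?V2 \<subseteq> {0}"
  proof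
    fix f assume "f \<in> ?U \<inter> ?V2"
    then obtain g0 g1 g2 where e: "f = embed 0 g0 + embed 1 g1" "f = embed 2 g2"
      by blast
    have "f v = 0" for v
    proof (cases "\<exists>z. v = Copy 2 z")
      case True
      then show ?thesis
        using e(1) by auto
    next
      case False
      then show ?thesis
        using e(2) by (cases v) auto
    qed
    then show "f \<in> {0}"
      by (simp add: fun_eq_iff)
  qed
  have "fun_space.dim ?W = fun_space.dim ?U + fun_space.dim ?V2"
    by (rule fun_space.dim_direct_sum[OF sub01 sub(3) int2 finT order_trans[OF U span]
          order_trans[OF V(3) span]])
  also have "fun_space.dim ?U = fun_space.dim ?V0 + fun_space.dim ?V1"
    by (rule fun_space.dim_direct_sum[OF sub(1,2) int1 finT order_trans[OF V(1) span]
          order_trans[OF V(2) span]])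
  finally have dimW: "fun_space.dim ?W = fun_space.dim (Dir (Suc n) \<theta>) + 2 * fun_space.dim (Dir n \<theta>)"
    unfolding dim_embed by linarith
  have "fun_space.dim ?W = fun_space.dim {f \<in> ?W. ?\<Phi> f = 0} + (if \<forall>f\<in>?W. ?\<Phi> f = 0 then 0 else 1)"
    by (rule fun_space.dim_kernel[OF subW finT order_trans[OF W span]])
      (simp_all add: laplacian_add laplacian_scale)
  moreover have "{f \<in> ?W. ?\<Phi> f = 0} = Dir (Suc (Suc n)) \<theta>"
    unfolding Dir_step_vanishing[of n \<theta>, symmetric] using assms by auto
  moreover have "(\<forall>f\<in>?W. ?\<Phi> f = 0) \<longleftrightarrow> (\<forall>x y. (0, 0, x, y) \<in> cauchy_data (Suc n) \<theta> \<longrightarrow> x + y = 0)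
      \<and> (\<forall>w u. (0, 0, w, u) \<in> cauchy_data n \<theta> \<longrightarrow> w = 0)"
  proof -
    have \<Phi>: "?\<Phi> (embed 0 g0 + embed 1 g1 + embed 2 g2)
        = laplacian (G (Suc n)) g0 (left (Suc n)) + laplacian (G (Suc n)) g0 (right (Suc n))
          + laplacian (G n) g1 (left n) + laplacian (G n) g2 (left n)"
      if "g0 \<in> Dir (Suc n) \<theta>" "g1 \<in> Dir n \<theta>" "g2 \<in> Dir n \<theta>" for g0 g1 g2
    proof -
      have eq: "(embed 0 g0 + embed 1 g1 + embed 2 g2) \<circ> glue 0 (boundary (G (Suc n))) = g0"
        "(embed 0 g0 + embed 1 g1 + embed 2 g2) \<circ> glue 1 {left n} = g1"
        "(embed 0 g0 + embed 1 g1 + embed 2 g2) \<circ> glue 2 {left n} = g2"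
        using that by (auto simp: fun_eq_iff glue_def Dir_iff supported_def boundary_G)
      show ?thesis
        unfolding laplacian_G_step(4) eq by simp
    qed
    have 0: "(0 :: vertex \<Rightarrow> real) \<in> Dir m \<theta>" "laplacian (G m) 0 x = 0" for m x
      using subspace_Dir[of m \<theta>] by (auto simp: fun_space.subspace_def laplacian_def)
    have W_iff: "(\<forall>f\<in>?W. ?\<Phi> f = 0) \<longleftrightarrow>
        (\<forall>g0\<in>Dir (Suc n) \<theta>. \<forall>g1\<in>Dir n \<theta>. \<forall>g2\<in>Dir n \<theta>. ?\<Phi> (embed 0 g0 + embed 1 g1 + embed 2 g2) = 0)"
      by blast
    show ?thesis
      unfolding W_iff dirichlet_cauchy_data
    \<comment> \<open>For the forward direction two components of the triple are set to 0, which
      isolates the flow of one piece.\<close>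
    proof (intro iffI conjI allI impI ballI)
      fix x y
      assume *: "\<forall>g0\<in>Dir (Suc n) \<theta>. \<forall>g1\<in>Dir n \<theta>. \<forall>g2\<in>Dir n \<theta>. ?\<Phi> (embed 0 g0 + embed 1 g1 + embed 2 g2) = 0"
        and "\<exists>f\<in>Dir (Suc n) \<theta>. laplacian (G (Suc n)) f (left (Suc n)) = x
          \<and> laplacian (G (Suc n)) f (right (Suc n)) = y"
      then obtain g0 where g0: "g0 \<in> Dir (Suc n) \<theta>" "laplacian (G (Suc n)) g0 (left (Suc n)) = x"
          "laplacian (G (Suc n)) g0 (right (Suc n)) = y"
        by blast
      then have "?\<Phi> (embed 0 g0 + embed 1 0 + embed 2 0) = 0"
        using * 0(1) by blast
      then show "x + y = 0"
        using \<Phi>[OF g0(1) 0(1) 0(1)] g0 by (simp add: 0(2))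
    next
      fix w u
      assume *: "\<forall>g0\<in>Dir (Suc n) \<theta>. \<forall>g1\<in>Dir n \<theta>. \<forall>g2\<in>Dir n \<theta>. ?\<Phi> (embed 0 g0 + embed 1 g1 + embed 2 g2) = 0"
        and "\<exists>f\<in>Dir n \<theta>. laplacian (G n) f (left n) = w \<and> laplacian (G n) f (right n) = u"
      then obtain g1 where g1: "g1 \<in> Dir n \<theta>" "laplacian (G n) g1 (left n) = w"
        by blast
      then have "?\<Phi> (embed 0 0 + embed 1 g1 + embed 2 0) = 0"
        using * 0(1) by blast
      then show "w = 0"
        using \<Phi>[OF 0(1) g1(1) 0(1)] g1 by (simp add: 0(2))
    next
      fix g0 g1 g2
      assume *: "(\<forall>x y. (\<exists>f\<in>Dir (Suc n) \<theta>. laplacian (G (Suc n)) f (left (Suc n)) = x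
          \<and> laplacian (G (Suc n)) f (right (Suc n)) = y) \<longrightarrow> x + y = 0)
        \<and> (\<forall>w u. (\<exists>f\<in>Dir n \<theta>. laplacian (G n) f (left n) = w \<and> laplacian (G n) f (right n) = u) \<longrightarrow> w = 0)"
        and g: "g0 \<in> Dir (Suc n) \<theta>" "g1 \<in> Dir n \<theta>" "g2 \<in> Dir n \<theta>"
      then have "laplacian (G (Suc n)) g0 (left (Suc n)) + laplacian (G (Suc n)) g0 (right (Suc n)) = 0"
        "laplacian (G n) g1 (left n) = 0" "laplacian (G n) g2 (left n) = 0"
        by blast+
      then show "?\<Phi> (embed 0 g0 + embed 1 g1 + embed 2 g2) = 0"
        using \<Phi>[OF g] by simp
    qed
  qed
  ultimately show ?thesis
    using dimW by simp
qed

text \<open>A pair of Dirichlet eigenfunctions extended by zero can violate the eigenvalue equation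
  only at the glued vertex, which costs at most one dimension.\<close>

lemma dim_Dir_le_eig_mult:
  "fun_space.dim (Dir (Suc n) \<theta>) + fun_space.dim (Dir n \<theta>) \<le> eig_mult (\<Gamma> (Suc n)) \<theta> + 1"
proof -
  let ?X = "verts (\<Gamma> (Suc n))"
  let ?V0 = "embed 0 ` Dir (Suc n) \<theta>" and ?V1 = "embed 1 ` Dir n \<theta>"
  let ?W = "{x + y |x y. x \<in> ?V0 \<and> y \<in> ?V1}"
  let ?T = "(\<lambda>x. indicator {x} :: vertex \<Rightarrow> real) ` ?X"
  let ?\<Phi> = "\<lambda>f. laplacian (\<Gamma> (Suc n)) f Glued"
  have finT: "finite ?T"
    by (simp add: finite_verts_\<Gamma>)
  have V: "?V0 \<subseteq> supported ?X" "?V1 \<subseteq> supported ?X"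
    unfolding verts_\<Gamma>_Suc by (auto simp: Dir_iff intro!: embed_supported)
  have span: "supported ?X \<subseteq> fun_space.span ?T"
    by (rule supported_subset_span) (rule finite_verts_\<Gamma>)
  have sub: "fun_space.subspace ?V0" "fun_space.subspace ?V1"
    by (intro subspace_embed subspace_Dir)+
  have subW: "fun_space.subspace ?W"
    using sub by (rule fun_space.subspace_sums)
  have W: "?W \<subseteq> supported ?X"
    by (rule sums_supported[OF V])
  have int: "?V0 \<inter> ?V1 \<subseteq> {0}"
    by (rule embed_Int) simp
  have "fun_space.dim (Dir (Suc n) \<theta>) + fun_space.dim (Dir n \<theta>) = fun_space.dim ?W"
    using fun_space.dim_direct_sum[OF sub int finT order_trans[OF V(1) span] order_trans[OF V(2) span]]
    by (simp add: dim_embed)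
  also have "\<dots> \<le> fun_space.dim {f \<in> ?W. ?\<Phi> f = 0} + 1"
    using fun_space.dim_kernel[OF subW finT order_trans[OF W span], of ?\<Phi>]
    by (simp add: laplacian_add laplacian_scale)
  finally have *: "fun_space.dim (Dir (Suc n) \<theta>) + fun_space.dim (Dir n \<theta>)
      \<le> fun_space.dim {f \<in> ?W. ?\<Phi> f = 0} + 1" .
  have "{f \<in> ?W. ?\<Phi> f = 0} \<subseteq> eigenspace (\<Gamma> (Suc n)) \<theta>"
  proof
    fix f assume f: "f \<in> {f \<in> ?W. ?\<Phi> f = 0}"
    then obtain g0 g1 where g: "g0 \<in> Dir (Suc n) \<theta>" "g1 \<in> Dir n \<theta>"
      and f_eq: "f = embed 0 g0 + embed 1 g1"
      by blast
    have eq: "f \<circ> glue 0 (boundary (G (Suc n))) = g0" "f \<circ> glue 1 (boundary (G n)) = g1"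
      using g by (auto simp: f_eq fun_eq_iff glue_def Dir_iff supported_def)
    have "laplacian (\<Gamma> (Suc n)) f x = \<theta> * f x" if "x \<in> ?X" for x
      using that g f laplacian_\<Gamma>_Suc[of _ n f] unfolding verts_\<Gamma>_Suc eq
      by (auto simp: Dir_iff solutions_def f_eq)
    moreover have "f \<in> supported ?X"
      using f W by blast
    ultimately show "f \<in> eigenspace (\<Gamma> (Suc n)) \<theta>"
      by (simp add: eigenspace_def supported_def)
  qed
  then have "fun_space.dim {f \<in> ?W. ?\<Phi> f = 0} \<le> eig_mult (\<Gamma> (Suc n)) \<theta>"
    unfolding eig_mult_def
    by (rule dim_le_of_supported[OF finite_verts_\<Gamma>[of "Suc n"]])
      (auto simp: eigenspace_def supported_def)
  then show ?thesis
    using * by linarith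
qed

section \<open>The four shapes of Cauchy data\<close>

declare G.simps(1,2) [simp del]

text \<open>\<open>regular\<close> describes the levels before the birth of \<open>\<theta>\<close> and \<open>nascent\<close> the level of birth;
  afterwards \<open>decoupled\<close> and \<open>polar\<close> alternate.  The two vanishing-flow patterns of Dirichlet
  solutions that decide the multiplicities are no flow at all (\<open>decoupled\<close>) and opposite flows
  (\<open>polar\<close>).\<close>

definition regular :: "nat \<Rightarrow> real \<Rightarrow> real \<Rightarrow> real \<Rightarrow> bool" where
  "regular n \<theta> A B \<longleftrightarrow> B \<noteq> 0 \<and>
    (\<forall>p q w u. (p, q, w, u) \<in> cauchy_data n \<theta> \<longleftrightarrow> w = A * p + B * q \<and> u = B * p + A * q)"

definition nascent :: "nat \<Rightarrow> real \<Rightarrow> real \<Rightarrow> bool" where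
  "nascent n \<theta> \<alpha> \<longleftrightarrow>
    (\<forall>p q w u. (p, q, w, u) \<in> cauchy_data n \<theta> \<longleftrightarrow> q = - p \<and> w - u = 2 * \<alpha> * p)"

definition decoupled :: "nat \<Rightarrow> real \<Rightarrow> real \<Rightarrow> bool" where
  "decoupled n \<theta> A \<longleftrightarrow> (\<forall>p q w u. (p, q, w, u) \<in> cauchy_data n \<theta> \<longleftrightarrow> w = A * p \<and> u = A * q)"

definition polar :: "nat \<Rightarrow> real \<Rightarrow> real \<Rightarrow> bool" where
  "polar n \<theta> s \<longleftrightarrow> (\<forall>p q w u. (p, q, w, u) \<in> cauchy_data n \<theta> \<longleftrightarrow> q = p \<and> w + u = 2 * s * p)"

section \<open>Transitions between the shapes under gluing\<close>

lemma Dir_Glued: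
  assumes "f \<in> Dir (Suc (Suc n)) \<theta>"
  obtains x y c d w u where "(f Glued, f Glued, x, y) \<in> cauchy_data (Suc n) \<theta>"
    "(f Glued, 0, c, w) \<in> cauchy_data n \<theta>" "(f Glued, 0, d, u) \<in> cauchy_data n \<theta>"
    "x + y + c + d = \<theta> * f Glued"
proof -
  have f: "f \<in> solutions (Suc (Suc n)) \<theta>" and "f \<in> supported (inside (Suc (Suc n)))"
    using assms by (simp_all add: Dir_iff)
  moreover have "Copy i (right n) \<notin> inside (Suc (Suc n))" if "i \<noteq> 0" for i
    using that unfolding mem_inside_G_step(1) by (simp add: boundary_G)
  ultimately have "f (Copy 1 (right n)) = 0" "f (Copy 2 (right n)) = 0"
    unfolding supported_def by auto
  with cauchy_data_of_solution[OF f] show ?thesis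
    using that by metis
qed

abbreviation dir_mult :: "nat \<Rightarrow> real \<Rightarrow> nat" where
  "dir_mult n \<theta> \<equiv> fun_space.dim (Dir n \<theta>)"

lemma dim_singleton_0: "fun_space.dim {0 :: 'v \<Rightarrow> real} = 0"
  using fun_space.dim_eq_card[of "{}" "{0 :: 'v \<Rightarrow> real}", OF _ fun_space.independent_empty] by simp

lemma dir_mult_eq_0_iff: "dir_mult n \<theta> = 0 \<longleftrightarrow> \<theta> \<notin> dirichlet_spectrum (G n)"
proof
  show "\<theta> \<notin> dirichlet_spectrum (G n)" if "dir_mult n \<theta> = 0"
    using that dir.dim_E_pos[of \<theta> n] unfolding dir_point_spectrum dir_E by auto
  assume "\<theta> \<notin> dirichlet_spectrum (G n)"
  then have "Dir n \<theta> \<subseteq> {0}"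
    by (auto simp: dirichlet_spectrum_def zero_fun_def)
  then have "dir_mult n \<theta> \<le> fun_space.dim {0 :: vertex \<Rightarrow> real}"
    by (intro dim_le_of_supported[of "{}"]) (auto simp: supported_def)
  then show "dir_mult n \<theta> = 0"
    by (simp add: dim_singleton_0)
qed

lemma dirichlet_spectrum_iff: "\<theta> \<in> dirichlet_spectrum (G n) \<longleftrightarrow> (\<exists>f\<in>Dir n \<theta>. f \<noteq> 0)"
  by (simp add: dirichlet_spectrum_def zero_fun_def)

text \<open>The nascent piece requires opposite values at its ends; being identified, they force t =
  0. The two new ends then no longer see each other and keep only the diagonal coefficient
  \<open>A\<close>. The nascent Dirichlet eigenfunction has total flow different from 0, so the
  balance condition costs one dimension.\<close>

lemma decoupled_after_nascent:
  assumes R: "regular n \<theta> A B" and N: "nascent (Suc n) \<theta> \<alpha>"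
  shows "decoupled (Suc (Suc n)) \<theta> A"
    and "dir_mult (Suc n) \<theta> + 2 * dir_mult n \<theta> = dir_mult (Suc (Suc n)) \<theta> + 1"
proof -
  have R': "(p, q, w, u) \<in> cauchy_data n \<theta> \<longleftrightarrow> w = A * p + B * q \<and> u = B * p + A * q" for p q w u
    using R by (simp add: regular_def)
  have N': "(p, q, w, u) \<in> cauchy_data (Suc n) \<theta> \<longleftrightarrow> q = - p \<and> w - u = 2 * \<alpha> * p" for p q w u
    using N by (simp add: nascent_def)
  show "decoupled (Suc (Suc n)) \<theta> A"
    unfolding decoupled_def cauchy_data_step R' N'
  proof (intro allI iffI)
    fix p q w u
    assume "w = A * p \<and> u = A * q"
    then show "\<exists>t x y c d. (t = - t \<and> x - y = 2 * \<alpha> * t) \<and> (c = A * t + B * p \<and> w = B * t + A * p)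
        \<and> (d = A * t + B * q \<and> u = B * t + A * q) \<and> x + y + c + d = \<theta> * t"
      \<comment> \<open>The larger piece cancels the flow B (p + q) of the smaller ones by two equal
        flows. Four witnesses suffice for five variables because \<open>x\<close> and
        \<open>y\<close> agree.\<close>
      by (intro exI[of _ 0] exI[of _ "- B * (p + q) / 2"] exI[of _ "B * p"] exI[of _ "B * q"])
        (simp add: field_simps)
  qed auto
  have "f Glued = 0" if f: "f \<in> Dir (Suc (Suc n)) \<theta>" for f
    using f by (rule Dir_Glued) (auto simp: N')
  moreover have "(0, 0, 1, 1) \<in> cauchy_data (Suc n) \<theta>"
    by (simp add: N')
  then have "\<not> (\<forall>x y. (0, 0, x, y) \<in> cauchy_data (Suc n) \<theta> \<longrightarrow> x + y = 0)"
    by force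
  ultimately show "dir_mult (Suc n) \<theta> + 2 * dir_mult n \<theta> = dir_mult (Suc (Suc n)) \<theta> + 1"
    using dim_Dir_step[of n \<theta>] by simp
qed

text \<open>Each nascent copy reverses the value \<open>t\<close>, so both new ends carry - t.
  Adding the two flow relations to the balance 2 A t + c + d = \<theta> t leaves only w + u
  determined, which gives the coefficient.\<close>

lemma polar_after_decoupled:
  assumes N: "nascent n \<theta> \<alpha>" and D: "decoupled (Suc n) \<theta> A"
  shows "polar (Suc (Suc n)) \<theta> ((2 * A + 4 * \<alpha> - \<theta>) / 2)"
    and "dir_mult (Suc n) \<theta> + 2 * dir_mult n \<theta> = dir_mult (Suc (Suc n)) \<theta> + 1"
proof -
  have N': "(p, q, w, u) \<in> cauchy_data n \<theta> \<longleftrightarrow> q = - p \<and> w - u = 2 * \<alpha> * p" for p q w u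
    using N by (simp add: nascent_def)
  have D': "(p, q, w, u) \<in> cauchy_data (Suc n) \<theta> \<longleftrightarrow> w = A * p \<and> u = A * q" for p q w u
    using D by (simp add: decoupled_def)
  show "polar (Suc (Suc n)) \<theta> ((2 * A + 4 * \<alpha> - \<theta>) / 2)"
    unfolding polar_def cauchy_data_step N' D'
  proof (intro allI iffI)
    fix p q w u
    assume *: "q = p \<and> w + u = 2 * ((2 * A + 4 * \<alpha> - \<theta>) / 2) * p"
    moreover have "2 * ((2 * A + 4 * \<alpha> - \<theta>) / 2) * p = (2 * A + 4 * \<alpha> - \<theta>) * p"
      by simp
    ultimately have "u = (2 * A + 4 * \<alpha> - \<theta>) * p - w"
      by linarith
    with * show "\<exists>t x y c d. (x = A * t \<and> y = A * t) \<and> (p = - t \<and> c - w = 2 * \<alpha> * t)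
        \<and> (q = - t \<and> d - u = 2 * \<alpha> * t) \<and> x + y + c + d = \<theta> * t"
      by (intro exI[of _ "- p"] exI[of _ "- A * p"] exI[of _ "w - 2 * \<alpha> * p"] exI[of _ "u - 2 * \<alpha> * p"])
        (simp add: algebra_simps)
  qed (auto simp: algebra_simps)
  have "f Glued = 0" if f: "f \<in> Dir (Suc (Suc n)) \<theta>" for f
    using f by (rule Dir_Glued) (auto simp: N')
  moreover have "(0, 0, 1, 1) \<in> cauchy_data n \<theta>"
    by (simp add: N')
  then have "\<not> (\<forall>w u. (0, 0, w, u) \<in> cauchy_data n \<theta> \<longrightarrow> w = 0)"
    by force
  ultimately show "dir_mult (Suc n) \<theta> + 2 * dir_mult n \<theta> = dir_mult (Suc (Suc n)) \<theta> + 1"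
    using dim_Dir_step[of n \<theta>] by auto
qed

text \<open>The quantity \<open>\<theta> - 2 * A - 2 * s\<close> equals \<open>4 * B\<close> when it first occurs and doubles with every
  passage from \<open>polar\<close> to \<open>polar\<close>, so it never vanishes.\<close>

lemma decoupled_after_polar:
  assumes D: "decoupled n \<theta> A" and P: "polar (Suc n) \<theta> s" and e: "\<theta> - 2 * A - 2 * s \<noteq> 0"
  shows "decoupled (Suc (Suc n)) \<theta> A"
    and "dir_mult (Suc n) \<theta> + 2 * dir_mult n \<theta> = dir_mult (Suc (Suc n)) \<theta>"
proof -
  have D': "(p, q, w, u) \<in> cauchy_data n \<theta> \<longleftrightarrow> w = A * p \<and> u = A * q" for p q w u
    using D by (simp add: decoupled_def)
  have P': "(p, q, w, u) \<in> cauchy_data (Suc n) \<theta> \<longleftrightarrow> q = p \<and> w + u = 2 * s * p" for p q w u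
    using P by (simp add: polar_def)
  show "decoupled (Suc (Suc n)) \<theta> A"
    unfolding decoupled_def cauchy_data_step D' P'
  proof (intro allI iffI)
    fix p q w u :: real
    assume "w = A * p \<and> u = A * q"
    then show "\<exists>t x y c d. (t = t \<and> x + y = 2 * s * t) \<and> (c = A * t \<and> w = A * p)
        \<and> (d = A * t \<and> u = A * q) \<and> x + y + c + d = \<theta> * t"
      by (intro exI[of _ 0]) simp
  qed auto
  have "f Glued = 0" if f: "f \<in> Dir (Suc (Suc n)) \<theta>" for f
    using f
  proof (rule Dir_Glued)
    fix x y c d w u
    assume "(f Glued, f Glued, x, y) \<in> cauchy_data (Suc n) \<theta>" "(f Glued, 0, c, w) \<in> cauchy_data n \<theta>"
      "(f Glued, 0, d, u) \<in> cauchy_data n \<theta>" "x + y + c + d = \<theta> * f Glued"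
    then have "(\<theta> - 2 * A - 2 * s) * f Glued = 0"
      by (simp add: D' P' algebra_simps)
    then show "f Glued = 0"
      using e by simp
  qed
  \<comment> \<open>Dirichlet solutions of the polar piece have opposite flows and those of the
    decoupled copies none, so the balance is automatic and no dimension is lost.\<close>
  then show "dir_mult (Suc n) \<theta> + 2 * dir_mult n \<theta> = dir_mult (Suc (Suc n)) \<theta>"
    using dim_Dir_step[of n \<theta>] by (simp add: D' P')
qed

text \<open>As after nascent copies, except that polar copies carry \<open>t\<close> to their free
  ends without reversing its sign.\<close>

lemma polar_after_polar:
  assumes P: "polar n \<theta> s" and D: "decoupled (Suc n) \<theta> A"
  shows "polar (Suc (Suc n)) \<theta> ((2 * A + 4 * s - \<theta>) / 2)"
    and "dir_mult (Suc n) \<theta> + 2 * dir_mult n \<theta> = dir_mult (Suc (Suc n)) \<theta> + 1"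
proof -
  have P': "(p, q, w, u) \<in> cauchy_data n \<theta> \<longleftrightarrow> q = p \<and> w + u = 2 * s * p" for p q w u
    using P by (simp add: polar_def)
  have D': "(p, q, w, u) \<in> cauchy_data (Suc n) \<theta> \<longleftrightarrow> w = A * p \<and> u = A * q" for p q w u
    using D by (simp add: decoupled_def)
  show "polar (Suc (Suc n)) \<theta> ((2 * A + 4 * s - \<theta>) / 2)"
    unfolding polar_def cauchy_data_step P' D'
  proof (intro allI iffI)
    fix p q w u
    assume *: "q = p \<and> w + u = 2 * ((2 * A + 4 * s - \<theta>) / 2) * p"
    moreover have "2 * ((2 * A + 4 * s - \<theta>) / 2) * p = (2 * A + 4 * s - \<theta>) * p"
      by simp
    ultimately have "u = (2 * A + 4 * s - \<theta>) * p - w"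
      by linarith
    with * show "\<exists>t x y c d. (x = A * t \<and> y = A * t) \<and> (p = t \<and> c + w = 2 * s * t)
        \<and> (q = t \<and> d + u = 2 * s * t) \<and> x + y + c + d = \<theta> * t"
      by (intro exI[of _ p] exI[of _ "A * p"] exI[of _ "2 * s * p - w"] exI[of _ "2 * s * p - u"])
        (simp add: algebra_simps)
  qed (auto simp: algebra_simps)
  have "f Glued = 0" if f: "f \<in> Dir (Suc (Suc n)) \<theta>" for f
    using f by (rule Dir_Glued) (auto simp: P')
  moreover have "(0, 0, 1, -1) \<in> cauchy_data n \<theta>"
    by (simp add: P')
  then have "\<not> (\<forall>w u. (0, 0, w, u) \<in> cauchy_data n \<theta> \<longrightarrow> w = 0)"
    by force
  ultimately show "dir_mult (Suc n) \<theta> + 2 * dir_mult n \<theta> = dir_mult (Suc (Suc n)) \<theta> + 1"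
    using dim_Dir_step[of n \<theta>] by auto
qed

text \<open>Eliminating the flows leaves e t = B (p + q), so only the symmetric part of the boundary
  values acts on the glued vertex. On antisymmetric data the new matrix keeps the eigenvalue
  \<open>A\<close>; on symmetric data it is A + 2 B^2 / e, with a pole at e = 0. There q = - p is
  forced, equal flows become free, and \<open>A\<close> survives as the parameter of
  \<open>nascent\<close>.\<close>

lemma regular_step:
  assumes R: "regular n \<theta> A B" and R1: "regular (Suc n) \<theta> A1 B1"
    and not: "\<theta> \<notin> dirichlet_spectrum (G n)" "\<theta> \<notin> dirichlet_spectrum (G (Suc n))"
  defines "e \<equiv> \<theta> - 2 * A - 2 * A1 - 2 * B1"
  shows "e \<noteq> 0 \<Longrightarrow> regular (Suc (Suc n)) \<theta> (A + B\<^sup>2 / e) (B\<^sup>2 / e)"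
    and "e = 0 \<Longrightarrow> nascent (Suc (Suc n)) \<theta> A"
    and "e \<noteq> 0 \<Longrightarrow> \<theta> \<notin> dirichlet_spectrum (G (Suc (Suc n)))"
    and "e = 0 \<Longrightarrow> dir_mult (Suc (Suc n)) \<theta> = 1"
proof -
  have B: "B \<noteq> 0"
    using R by (simp add: regular_def)
  have R': "(p, q, w, u) \<in> cauchy_data n \<theta> \<longleftrightarrow> w = A * p + B * q \<and> u = B * p + A * q" for p q w u
    using R by (simp add: regular_def)
  have R1': "(p, q, w, u) \<in> cauchy_data (Suc n) \<theta> \<longleftrightarrow> w = A1 * p + B1 * q \<and> u = B1 * p + A1 * q" for p q w u
    using R1 by (simp add: regular_def)
  have data: "(p, q, w, u) \<in> cauchy_data (Suc (Suc n)) \<theta> \<longleftrightarrow>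
      (\<exists>t. e * t = B * (p + q) \<and> w = B * t + A * p \<and> u = B * t + A * q)" for p q w u
  proof
    assume "\<exists>t. e * t = B * (p + q) \<and> w = B * t + A * p \<and> u = B * t + A * q"
    then obtain t where "e * t = B * (p + q) \<and> w = B * t + A * p \<and> u = B * t + A * q"
      by blast
    then show "(p, q, w, u) \<in> cauchy_data (Suc (Suc n)) \<theta>"
      unfolding cauchy_data_step R' R1'
      by (intro exI[of _ t] exI[of _ "(A1 + B1) * t"] exI[of _ "A * t + B * p"] exI[of _ "A * t + B * q"])
        (simp add: e_def algebra_simps)
  next
    assume "(p, q, w, u) \<in> cauchy_data (Suc (Suc n)) \<theta>"
    then obtain t x y c d where "(t, t, x, y) \<in> cauchy_data (Suc n) \<theta>" "(t, p, c, w) \<in> cauchy_data n \<theta>"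
      "(t, q, d, u) \<in> cauchy_data n \<theta>" "x + y + c + d = \<theta> * t"
      unfolding cauchy_data_step by blast
    then show "\<exists>t. e * t = B * (p + q) \<and> w = B * t + A * p \<and> u = B * t + A * q"
      by (intro exI[of _ t]) (simp add: R' R1' e_def algebra_simps)
  qed
  have m0: "dir_mult n \<theta> = 0" "dir_mult (Suc n) \<theta> = 0"
    using not dir_mult_eq_0_iff by blast+
  {
    assume e: "e \<noteq> 0"
    have "(p, q, w, u) \<in> cauchy_data (Suc (Suc n)) \<theta> \<longleftrightarrow>
        w = (A + B\<^sup>2 / e) * p + B\<^sup>2 / e * q \<and> u = B\<^sup>2 / e * p + (A + B\<^sup>2 / e) * q" for p q w u
    proof -
      have "e * t = B * (p + q) \<longleftrightarrow> t = B * (p + q) / e" for t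
        using e by (auto simp: field_simps)
      then show ?thesis
        unfolding data by (simp add: power2_eq_square algebra_simps add_divide_distrib)
    qed
    then show "regular (Suc (Suc n)) \<theta> (A + B\<^sup>2 / e) (B\<^sup>2 / e)"
      using e B by (simp add: regular_def)
    have "f Glued = 0" if f: "f \<in> Dir (Suc (Suc n)) \<theta>" for f
      using f
    proof (rule Dir_Glued)
      fix x y c d w u
      assume "(f Glued, f Glued, x, y) \<in> cauchy_data (Suc n) \<theta>" "(f Glued, 0, c, w) \<in> cauchy_data n \<theta>"
        "(f Glued, 0, d, u) \<in> cauchy_data n \<theta>" "x + y + c + d = \<theta> * f Glued"
      then have "e * f Glued = 0"
        by (simp add: R' R1' e_def algebra_simps)
      then show "f Glued = 0"
        using e by simp
    qed
    then have "dir_mult (Suc (Suc n)) \<theta> = 0"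
      using dim_Dir_step[of n \<theta>] m0 by simp
    then show "\<theta> \<notin> dirichlet_spectrum (G (Suc (Suc n)))"
      using dir_mult_eq_0_iff by blast
  }
  {
    assume e: "e = 0"
    show N: "nascent (Suc (Suc n)) \<theta> A"
      unfolding nascent_def data
    proof (intro allI iffI)
      fix p q w u
      assume "q = - p \<and> w - u = 2 * A * p"
      then show "\<exists>t. e * t = B * (p + q) \<and> w = B * t + A * p \<and> u = B * t + A * q"
        using B e by (intro exI[of _ "(w - A * p) / B"]) (simp add: field_simps)
    next
      fix p q w u
      assume "\<exists>t. e * t = B * (p + q) \<and> w = B * t + A * p \<and> u = B * t + A * q"
      then obtain t where "B * (p + q) = 0" "w = B * t + A * p" "u = B * t + A * q"
        using e by auto
      moreover from this have "q = - p"
        using B by (simp add: eq_neg_iff_add_eq_0 add.commute)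
      ultimately show "q = - p \<and> w - u = 2 * A * p"
        by simp
    qed
    have "(0, 0, 1, 1) \<in> cauchy_data (Suc (Suc n)) \<theta>"
      using N by (simp add: nascent_def)
    then obtain f where "f \<in> Dir (Suc (Suc n)) \<theta>" "laplacian (G (Suc (Suc n))) f (left (Suc (Suc n))) = 1"
      unfolding dirichlet_cauchy_data by blast
    moreover have "laplacian (G (Suc (Suc n))) 0 (left (Suc (Suc n))) = 0"
      by (simp add: laplacian_def)
    ultimately have "f \<noteq> 0" "f \<in> Dir (Suc (Suc n)) \<theta>"
      by auto
    then have pos: "dir_mult (Suc (Suc n)) \<theta> \<noteq> 0"
      unfolding dir_mult_eq_0_iff dirichlet_spectrum_iff by blast
    have D0: "Dir n \<theta> \<subseteq> {0}" "Dir (Suc n) \<theta> \<subseteq> {0}"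
      using not by (auto simp: dirichlet_spectrum_iff)
    have embed_0: "embed i 0 = 0" for i
      by (rule vertex_fun_eqI) simp_all
    have image_0: "embed i ` V \<subseteq> {0}" if "V \<subseteq> {0}" for i V
      using image_mono[OF that, of "embed i"] by (simp add: embed_0)
    have sums_0: "{x + y |x y. x \<in> V \<and> y \<in> W} \<subseteq> {0}"
      if "V \<subseteq> {0}" "W \<subseteq> {0}" for V W :: "(vertex \<Rightarrow> real) set"
    proof
      fix f assume "f \<in> {x + y |x y. x \<in> V \<and> y \<in> W}"
      then obtain x y where "f = x + y" "x \<in> V" "y \<in> W"
        by blast
      moreover from this have "x = 0" "y = 0"
        using subsetD[OF that(1), of x] subsetD[OF that(2), of y] by simp_all
      ultimately show "f \<in> {0}"
        by simp
    qed
    have *: "{x + y |x y. x \<in> {x + y |x y. x \<in> embed 0 ` Dir (Suc n) \<theta> \<and> y \<in> embed 1 ` Dir n \<theta>}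
      \<and> y \<in> embed 2 ` Dir n \<theta>} \<subseteq> {0}"
      by (intro sums_0 image_0 D0)
    have K: "{f \<in> Dir (Suc (Suc n)) \<theta>. f Glued = 0} \<subseteq> {0}"
      unfolding Dir_step_vanishing by (rule order_trans[OF Collect_restrict *])
    have "fun_space.dim {f \<in> Dir (Suc (Suc n)) \<theta>. f Glued = 0} = 0"
    proof -
      have "fun_space.dim {f \<in> Dir (Suc (Suc n)) \<theta>. f Glued = 0} \<le> fun_space.dim {0 :: vertex \<Rightarrow> real}"
        using K by (intro dim_le_of_supported[of "{}"]) (auto simp: supported_def)
      then show ?thesis
        by (simp add: dim_singleton_0)
    qed
    moreover have "Dir (Suc (Suc n)) \<theta> \<subseteq> fun_space.span ((\<lambda>x. indicator {x}) ` inside (Suc (Suc n)))"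
      by (rule order_trans[OF _ supported_subset_span]) (auto simp: Dir_iff)
    then have "dir_mult (Suc (Suc n)) \<theta> = fun_space.dim {f \<in> Dir (Suc (Suc n)) \<theta>. f Glued = 0}
        + (if \<forall>f\<in>Dir (Suc (Suc n)) \<theta>. f Glued = 0 then 0 else 1)"
      by (intro fun_space.dim_kernel[OF subspace_Dir]) auto
    ultimately show "dir_mult (Suc (Suc n)) \<theta> = 1"
      using pos by (simp split: if_splits)
  }
qed

section \<open>The levels 0 and 1\<close>

lemma regular_0: "regular 0 \<theta> 1 (- 1)" and dirichlet_spectrum_0: "\<theta> \<notin> dirichlet_spectrum (G 0)"
proof -
  have inside: "inside 0 = {}"
    by (auto simp: boundary_def G.simps)
  have l: "laplacian (G 0) f (Base 0) = f (Base 0) - f (Base (Suc 0))"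
    "laplacian (G 0) f (Base (Suc 0)) = f (Base (Suc 0)) - f (Base 0)" for f
    by (simp_all add: laplacian_def conductance_def G.simps)
  have ends: "left 0 = Base 0" "right 0 = Base (Suc 0)"
    by (simp_all add: G.simps)
  have "(p, q, w, u) \<in> cauchy_data 0 \<theta> \<longleftrightarrow> w = p - q \<and> u = q - p" for p q w u
  proof
    assume "w = p - q \<and> u = q - p"
    then show "(p, q, w, u) \<in> cauchy_data 0 \<theta>"
      unfolding cauchy_data_def solutions_def inside ends l
      by (intro image_eqI[of _ _ "\<lambda>v. if v = Base 0 then p else q"]) simp_all
  qed (auto simp: cauchy_data_def ends l)
  then show "regular 0 \<theta> 1 (- 1)"
    by (auto simp: regular_def)
  have "f x = 0" if "f \<in> Dir 0 \<theta>" for f x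
    using that unfolding Dir_iff inside by (simp add: supported_def)
  then show "\<theta> \<notin> dirichlet_spectrum (G 0)"
    by (auto simp: dirichlet_spectrum_iff fun_eq_iff)
qed

text \<open>The value \<open>t\<close> at the middle vertex satisfies (2 - \<theta>) t = p + q, the
  loop contributing nothing. At \<theta> = 2 it is free, which makes 2 the eigenvalue born at level
  1.\<close>

lemma
  shows regular_1: "\<theta> \<noteq> 2 \<Longrightarrow> regular (Suc 0) \<theta> (1 - 1 / (2 - \<theta>)) (- 1 / (2 - \<theta>))"
    and nascent_1: "\<theta> = 2 \<Longrightarrow> nascent (Suc 0) \<theta> 1"
    and dirichlet_spectrum_1: "\<theta> \<noteq> 2 \<Longrightarrow> \<theta> \<notin> dirichlet_spectrum (G (Suc 0))"
    and dir_mult_1: "\<theta> = 2 \<Longrightarrow> dir_mult (Suc 0) \<theta> = 1"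
proof -
  have inside: "inside (Suc 0) = {Base (Suc 0)}"
    by (auto simp: boundary_def G.simps)
  have l: "laplacian (G (Suc 0)) f (Base 0) = f (Base 0) - f (Base (Suc 0))"
    "laplacian (G (Suc 0)) f (Base 2) = f (Base 2) - f (Base (Suc 0))"
    "laplacian (G (Suc 0)) f (Base (Suc 0)) = 2 * f (Base (Suc 0)) - f (Base 0) - f (Base 2)" for f
    by (simp_all add: laplacian_def conductance_def G.simps)
  have ends: "left (Suc 0) = Base 0" "right (Suc 0) = Base 2"
    by (simp_all add: G.simps)
  have data: "(p, q, w, u) \<in> cauchy_data (Suc 0) \<theta> \<longleftrightarrow>
      (\<exists>t. 2 * t - p - q = \<theta> * t \<and> w = p - t \<and> u = q - t)" for p q w u
  proof
    assume "\<exists>t. 2 * t - p - q = \<theta> * t \<and> w = p - t \<and> u = q - t"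
    then obtain t where "2 * t - p - q = \<theta> * t \<and> w = p - t \<and> u = q - t"
      by blast
    then show "(p, q, w, u) \<in> cauchy_data (Suc 0) \<theta>"
      unfolding cauchy_data_def solutions_def inside ends l
      by (intro image_eqI[of _ _ "\<lambda>v. if v = Base 0 then p else if v = Base (Suc 0) then t else q"])
        (simp_all add: l)
  qed (auto simp: cauchy_data_def solutions_def inside ends l)
  have Dir: "f \<in> Dir (Suc 0) \<theta> \<longleftrightarrow> f \<in> supported {Base (Suc 0)} \<and> 2 * f (Base (Suc 0)) = \<theta> * f (Base (Suc 0))" for f
    unfolding Dir_iff solutions_def inside by (auto simp: l supported_def)
  {
    assume \<theta>: "\<theta> \<noteq> 2"
    have "2 * t - p - q = \<theta> * t \<longleftrightarrow> t = (p + q) / (2 - \<theta>)" for t p q :: real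
      using \<theta> by (auto simp: field_simps)
    then have "(p, q, w, u) \<in> cauchy_data (Suc 0) \<theta> \<longleftrightarrow>
        w = p - (p + q) / (2 - \<theta>) \<and> u = q - (p + q) / (2 - \<theta>)" for p q w u
      unfolding data by simp
    then show "regular (Suc 0) \<theta> (1 - 1 / (2 - \<theta>)) (- 1 / (2 - \<theta>))"
      using \<theta> by (auto simp: regular_def left_diff_distrib add_divide_distrib)
    have "f x = 0" if "f \<in> Dir (Suc 0) \<theta>" for f x
      using that \<theta> unfolding Dir by (cases "x = Base (Suc 0)") (auto simp: supported_def)
    then show "\<theta> \<notin> dirichlet_spectrum (G (Suc 0))"
      by (auto simp: dirichlet_spectrum_iff fun_eq_iff)
  }
  {
    assume \<theta>: "\<theta> = 2"
    show "nascent (Suc 0) \<theta> 1"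
      unfolding nascent_def data
    proof (intro allI iffI)
      fix p q w u :: real
      assume "q = - p \<and> w - u = 2 * 1 * p"
      then show "\<exists>t. 2 * t - p - q = \<theta> * t \<and> w = p - t \<and> u = q - t"
        using \<theta> by (intro exI[of _ "p - w"]) auto
    qed (use \<theta> in auto)
    have "Dir (Suc 0) \<theta> = supported {Base (Suc 0)}"
      using \<theta> Dir by auto
    then show "dir_mult (Suc 0) \<theta> = 1"
      by (simp add: dim_supported)
  }
qed

section \<open>Multiplicities of Dirichlet eigenvalues\<close>

text \<open>If the denominator \<open>e\<close> of \<open>regular_step\<close> vanished, \<theta>
  would be an eigenvalue at that level; so the matrix form persists.\<close>

lemma regular_before_birth:
  assumes "\<And>m. m \<le> n \<Longrightarrow> \<theta> \<notin> dirichlet_spectrum (G m)"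
  shows "\<exists>A B. regular n \<theta> A B"
  using assms
proof (induction n rule: G.induct)
  case 1
  then show ?case
    using regular_0 by blast
next
  case 2
  then have "\<theta> \<noteq> 2"
    using dir_mult_1 dir_mult_eq_0_iff[of "Suc 0" \<theta>] by auto
  then show ?case
    using regular_1 by blast
next
  case (3 n)
  then obtain A B A1 B1 where R: "regular n \<theta> A B" "regular (Suc n) \<theta> A1 B1"
    by force
  have "\<theta> \<notin> dirichlet_spectrum (G n)" "\<theta> \<notin> dirichlet_spectrum (G (Suc n))"
    "\<theta> \<notin> dirichlet_spectrum (G (Suc (Suc n)))"
    using "3.prems" by auto
  then show ?case
    using regular_step[OF R] dir_mult_eq_0_iff[of "Suc (Suc n)" \<theta>] by (metis zero_neq_one)
qed

text \<open>From level 2 on the relation between \<theta>, \<alpha>, A and B is the pole condition e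
  = 0, with \<alpha> the diagonal coefficient two levels before birth; at level 1 it reads 2 = 2 + 2
  - 2. It later keeps the polar levels nondegenerate.\<close>

lemma bornE:
  assumes "\<theta> \<in> born k"
  obtains m A B \<alpha> where "k = Suc m" "regular m \<theta> A B" "nascent (Suc m) \<theta> \<alpha>"
    "\<theta> = 2 * \<alpha> + 2 * A + 2 * B" "dir_mult m \<theta> = 0" "dir_mult (Suc m) \<theta> = 1"
proof -
  have spec: "\<theta> \<in> dirichlet_spectrum (G k)" and not: "\<And>m. m < k \<Longrightarrow> \<theta> \<notin> dirichlet_spectrum (G m)"
    using assms by (auto simp: born_def)
  consider "k = 0" | "k = Suc 0" | n where "k = Suc (Suc n)"
    by (metis not0_implies_Suc)
  then show ?thesis
  proof cases
    case 1
    then show ?thesis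
      using spec dirichlet_spectrum_0 by simp
  next
    case 2
    then have \<theta>: "\<theta> = 2"
      using spec dirichlet_spectrum_1 by blast
    have "dir_mult 0 \<theta> = 0"
      using dirichlet_spectrum_0 dir_mult_eq_0_iff by blast
    then show ?thesis
      using that[OF 2 regular_0 nascent_1[OF \<theta>]] dir_mult_1[OF \<theta>] \<theta> by simp
  next
    case 3
    obtain A B A1 B1 where R: "regular n \<theta> A B" "regular (Suc n) \<theta> A1 B1"
      using regular_before_birth not 3 by (metis less_SucI less_Suc_eq_le)
    have not': "\<theta> \<notin> dirichlet_spectrum (G n)" "\<theta> \<notin> dirichlet_spectrum (G (Suc n))"
      using not 3 by auto
    have e: "\<theta> - 2 * A - 2 * A1 - 2 * B1 = 0"
      using regular_step(3)[OF R not'] spec 3 by blast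
    show ?thesis
      using that[OF 3 R(2) regular_step(2)[OF R not' e]] regular_step(4)[OF R not' e] e not'
        dir_mult_eq_0_iff by simp
  qed
qed

text \<open>The closed form of \<open>1, 0, 1, 1, 2, 4, 7, \<dots>\<close>, where from position 2 on each term is the preceding
  one plus twice the one before, minus one at even positions.\<close>

definition mult_seq :: "nat \<Rightarrow> real" where
  "mult_seq j = (4 * 2 ^ j + 9 + (23 - 6 * real j) * (- 1) ^ j) / 36"

lemma mult_seq_step:
  "mult_seq (2 * i + 3) = mult_seq (2 * i + 2) + 2 * mult_seq (2 * i + 1)"
  "mult_seq (2 * i + 4) = mult_seq (2 * i + 3) + 2 * mult_seq (2 * i + 2) - 1"
  unfolding mult_seq_def power_add power_mult by (simp_all add: field_simps)

text \<open>After birth the shapes have period two, so the induction advances two levels at a time.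
  It carries the constant \<open>A\<close>, a changing \<open>s\<close> and the nonvanishing
  quantity that \<open>decoupled_after_polar\<close> requires.\<close>

lemma dir_mult_born:
  assumes "\<theta> \<in> born k"
  shows "real (dir_mult (k + j) \<theta>) = mult_seq j"
proof -
  obtain m A B \<alpha> where k: "k = Suc m" and R: "regular m \<theta> A B" and N: "nascent (Suc m) \<theta> \<alpha>"
    and \<theta>: "\<theta> = 2 * \<alpha> + 2 * A + 2 * B" and m: "dir_mult m \<theta> = 0" "dir_mult (Suc m) \<theta> = 1"
    using assms by (rule bornE)
  note D1 = decoupled_after_nascent[OF R N]
  note P2 = polar_after_decoupled[OF N D1(1)]
  let ?s = "(2 * A + 4 * \<alpha> - \<theta>) / 2"
  have B: "B \<noteq> 0"
    using R by (simp add: regular_def)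
  have m1: "dir_mult (Suc (Suc m)) \<theta> = 0"
    using D1(2) m by simp
  have m2: "dir_mult (Suc (Suc (Suc m))) \<theta> = 1"
    using P2(2) m1 m by simp
  have *: "\<exists>s. decoupled (k + (2 * i + 1)) \<theta> A \<and> polar (k + (2 * i + 2)) \<theta> s \<and> \<theta> - 2 * A - 2 * s \<noteq> 0
      \<and> real (dir_mult (k + (2 * i + 1)) \<theta>) = mult_seq (2 * i + 1)
      \<and> real (dir_mult (k + (2 * i + 2)) \<theta>) = mult_seq (2 * i + 2)" for i
  proof (induction i)
    case 0
    have "\<theta> - 2 * A - 2 * ?s = 4 * B"
      by (simp add: \<theta> field_simps)
    then show ?case
      using D1(1) P2(1) B m1 m2 k by (intro exI[of _ ?s]) (simp add: mult_seq_def)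
  next
    case (Suc i)
    then obtain s where D: "decoupled (k + (2 * i + 1)) \<theta> A" and P: "polar (Suc (k + (2 * i + 1))) \<theta> s"
      and e: "\<theta> - 2 * A - 2 * s \<noteq> 0"
      and m: "real (dir_mult (k + (2 * i + 1)) \<theta>) = mult_seq (2 * i + 1)"
        "real (dir_mult (Suc (k + (2 * i + 1))) \<theta>) = mult_seq (2 * i + 2)"
      by auto
    note D' = decoupled_after_polar[OF D P e]
    note P' = polar_after_polar[OF P D'(1)]
    have "real (dir_mult (Suc (Suc (k + (2 * i + 1)))) \<theta>) = mult_seq (2 * i + 3)"
      using D'(2) m mult_seq_step(1)[of i] by linarith
    moreover from this have "real (dir_mult (Suc (Suc (Suc (k + (2 * i + 1))))) \<theta>) = mult_seq (2 * i + 4)"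
      using P'(2) m mult_seq_step(2)[of i] by linarith
    moreover have "\<theta> - 2 * A - 2 * ((2 * A + 4 * s - \<theta>) / 2) \<noteq> 0"
      using e by (simp add: field_simps)
    ultimately show ?case
      using D'(1) P'(1) by (intro exI[of _ "(2 * A + 4 * s - \<theta>) / 2"]) (simp add: eval_nat_numeral)
  qed
  consider "j = 0" | i where "j = 2 * i + 1" | i where "j = 2 * i + 2"
    by atomize_elim presburger
  then show ?thesis
  proof cases
    case 1
    then show ?thesis
      using m k by (simp add: mult_seq_def)
  next
    case (2 i)
    then show ?thesis
      using *[of i] by auto
  next
    case (3 i)
    then show ?thesis
      using *[of i] by auto
  qed
qed

section \<open>Counting eigenvalues\<close>

lemma finite_dirichlet_spectrum: "finite (dirichlet_spectrum (G n))"
  using dir.finite_point_spectrum[of n] by (simp only: dir_point_spectrum)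

lemma finite_born [simp]: "finite (born k)"
  by (rule finite_subset[OF _ finite_dirichlet_spectrum[of k]]) (auto simp: born_def)

lemma born_0: "born 0 = {}"
  using dirichlet_spectrum_0 by (auto simp: born_def)

lemma born_disjoint: "k \<noteq> l \<Longrightarrow> born k \<inter> born l = {}"
  by (cases k l rule: linorder_cases) (auto simp: born_def)

lemma roots_\<gamma>: "{\<theta>. poly (\<gamma> k) \<theta> = 0} = born k"
  by (auto simp: \<gamma>_def poly_prod)

lemma dirichlet_spectrum_subset_born: "dirichlet_spectrum (G n) \<subseteq> (\<Union>k\<le>n. born k)"
proof
  fix \<theta> assume \<theta>: "\<theta> \<in> dirichlet_spectrum (G n)"
  define k where "k = (LEAST k. \<theta> \<in> dirichlet_spectrum (G k))"
  have "\<theta> \<in> dirichlet_spectrum (G k)"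
    unfolding k_def by (rule LeastI[of "\<lambda>k. \<theta> \<in> dirichlet_spectrum (G k)", OF \<theta>])
  moreover have "k \<le> n"
    unfolding k_def by (rule Least_le[of "\<lambda>k. \<theta> \<in> dirichlet_spectrum (G k)", OF \<theta>])
  moreover have "\<theta> \<notin> dirichlet_spectrum (G m)" if "m < k" for m
    using that unfolding k_def by (rule not_less_Least)
  ultimately show "\<theta> \<in> (\<Union>k\<le>n. born k)"
    by (auto simp: born_def)
qed

text \<open>Diagonalizability, with the eigenvalues grouped by birth. Those born at level n - 1 are
  absent from level n and enter with \<open>mult_seq 1 = 0\<close>.\<close>

lemma card_inside_le:
  "real (card (inside n)) \<le> (\<Sum>k\<le>n. real (card (born k)) * mult_seq (n - k))"
proof -
  have "card (inside n) \<le> (\<Sum>\<theta>\<in>dirichlet_spectrum (G n). dir_mult n \<theta>)"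
    using dir.card_le_sum_dim_E[of n] unfolding dir_point_spectrum dir_E .
  also have "\<dots> \<le> (\<Sum>\<theta>\<in>(\<Union>k\<le>n. born k). dir_mult n \<theta>)"
    by (rule sum_mono2[OF _ dirichlet_spectrum_subset_born]) auto
  also have "\<dots> = (\<Sum>k\<le>n. \<Sum>\<theta>\<in>born k. dir_mult n \<theta>)"
    using born_disjoint by (intro sum.UNION_disjoint) auto
  finally have "real (card (inside n)) \<le> real (\<Sum>k\<le>n. \<Sum>\<theta>\<in>born k. dir_mult n \<theta>)"
    by (rule of_nat_mono)
  also have "\<dots> = (\<Sum>k\<le>n. \<Sum>\<theta>\<in>born k. real (dir_mult n \<theta>))"
    by simp
  also have "\<dots> = (\<Sum>k\<le>n. \<Sum>\<theta>\<in>born k. mult_seq (n - k))"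
  proof (intro sum.cong refl)
    fix k \<theta> assume "k \<in> {..n}" "\<theta> \<in> born k"
    then show "real (dir_mult n \<theta>) = mult_seq (n - k)"
      using dir_mult_born[of \<theta> k "n - k"] by simp
  qed
  finally show ?thesis
    by simp
qed

lemma card_inside_ge: "(4 * 2 ^ n - 4) / 6 \<le> real (card (inside n))"
proof -
  have "real (card (inside n)) = (4 * 2 ^ n - 3 - (- 1) ^ n) / 6"
  proof (induction n rule: G.induct)
    case (3 n)
    then show ?case
      unfolding card_inside_step by (simp add: field_simps)
  qed (simp_all add: card_inside_0 card_inside_1)
  moreover have "(- 1 :: real) ^ n \<le> 1"
    by (cases "even n") auto
  ultimately show ?thesis
    by simp
qed

lemma sum_eig_mult_le: "finite F \<Longrightarrow> (\<Sum>\<theta>\<in>F. eig_mult (\<Gamma> n) \<theta>) \<le> 2 ^ n"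
  using gam.sum_dim_E_le[of F n] unfolding gam_E eig_mult_def card_verts_\<Gamma> .

lemma finite_spectrum_\<Gamma>: "finite (spectrum (\<Gamma> n))"
  using gam.finite_point_spectrum[of n] by (simp only: gam_point_spectrum)

lemma eig_mult_eq_0: "\<theta> \<notin> spectrum (\<Gamma> n) \<Longrightarrow> eig_mult (\<Gamma> n) \<theta> = 0"
proof -
  assume "\<theta> \<notin> spectrum (\<Gamma> n)"
  then have "eigenspace (\<Gamma> n) \<theta> \<subseteq> {0}"
    by (auto simp: spectrum_def zero_fun_def)
  then have "eig_mult (\<Gamma> n) \<theta> \<le> fun_space.dim {0 :: vertex \<Rightarrow> real}"
    unfolding eig_mult_def by (intro dim_le_of_supported[of "{}"]) (auto simp: supported_def)
  then show ?thesis
    by (simp add: dim_singleton_0)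
qed

lemma eig_mult_ge:
  assumes "\<theta> \<in> born k" "k < n"
  shows "mult_seq (n - k) + mult_seq (n - 1 - k) - 1 \<le> real (eig_mult (\<Gamma> n) \<theta>)"
proof -
  obtain m where n: "n = Suc m" and "k \<le> m"
    using assms(2) by (metis less_Suc_eq_le less_imp_Suc_add)
  then have "real (dir_mult n \<theta>) = mult_seq (n - k)" "real (dir_mult m \<theta>) = mult_seq (n - 1 - k)"
    using dir_mult_born[OF assms(1), of "n - k"] dir_mult_born[OF assms(1), of "m - k"] by simp_all
  moreover have "real (dir_mult n \<theta>) + real (dir_mult m \<theta>) \<le> real (eig_mult (\<Gamma> n) \<theta>) + 1"
    using dim_Dir_le_eig_mult[of m \<theta>] unfolding n by linarith
  ultimately show ?thesis
    by linarith
qed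

section \<open>Weak convergence\<close>

definition \<nu>_mass :: "nat \<Rightarrow> real set \<Rightarrow> real" where
  "\<nu>_mass n A = (\<Sum>\<theta>\<in>spectrum (\<Gamma> n) \<inter> A. real (eig_mult (\<Gamma> n) \<theta>)) / 2 ^ n"

text \<open>The weight is (2/3) 2^-(j+3), rewritten in terms of the birth level: each eigenvalue
  born at level k has mass 2^-k / 6.\<close>

definition \<mu>_term :: "real set \<Rightarrow> nat \<Rightarrow> real" where
  "\<mu>_term A j = real (card (born (j + 1) \<inter> A)) / (6 * 2 ^ (j + 1))"

lemma measure_\<nu>:
  assumes "A \<in> sets borel"
  shows "measure (\<nu> n) A = \<nu>_mass n A"
proof -
  have "(\<Sum>\<theta>\<in>spectrum (\<Gamma> n). of_nat (eig_mult (\<Gamma> n) \<theta>) * emeasure (return borel \<theta>) A)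
      = (\<Sum>\<theta>\<in>spectrum (\<Gamma> n). if \<theta> \<in> A then ennreal (real (eig_mult (\<Gamma> n) \<theta>)) else 0)"
    using assms by (intro sum.cong) (auto simp: ennreal_of_nat_eq_real_of_nat)
  also have "\<dots> = ennreal (\<Sum>\<theta>\<in>spectrum (\<Gamma> n) \<inter> A. real (eig_mult (\<Gamma> n) \<theta>))"
    by (simp add: sum.inter_restrict[OF finite_spectrum_\<Gamma>, symmetric] sum_ennreal)
  finally have "emeasure (\<nu> n) A = ennreal (\<nu>_mass n A)"
    unfolding emeasure_\<nu>[OF assms] \<nu>_mass_def
    by (simp add: ennreal_mult[symmetric] sum_nonneg)
  then show ?thesis
    unfolding measure_def by (simp add: \<nu>_mass_def sum_nonneg)
qed

lemma \<nu>_mass_add_le: "\<nu>_mass n A + \<nu>_mass n (- A) \<le> 1"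
proof -
  let ?m = "\<lambda>\<theta>. real (eig_mult (\<Gamma> n) \<theta>)"
  have "(\<Sum>\<theta>\<in>spectrum (\<Gamma> n) \<inter> A. ?m \<theta>) + (\<Sum>\<theta>\<in>spectrum (\<Gamma> n) \<inter> - A. ?m \<theta>)
      = (\<Sum>\<theta>\<in>spectrum (\<Gamma> n). ?m \<theta>)"
    using sum.Int_Diff[OF finite_spectrum_\<Gamma>, of ?m n A] by (simp add: Diff_eq)
  also have "\<dots> = real (\<Sum>\<theta>\<in>spectrum (\<Gamma> n). eig_mult (\<Gamma> n) \<theta>)"
    by simp
  also have "\<dots> \<le> real (2 ^ n)"
    by (rule of_nat_mono[OF sum_eig_mult_le[OF finite_spectrum_\<Gamma>]])
  finally show ?thesis
    unfolding \<nu>_mass_def add_divide_distrib[symmetric] by simp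
qed

lemma \<nu>_mass_nonneg: "0 \<le> \<nu>_mass n A"
  by (simp add: \<nu>_mass_def sum_nonneg)

lemma tendsto_eig_mult_bound:
  "(\<lambda>n. (mult_seq (n - k) + mult_seq (n - 1 - k) - 1) / 2 ^ n) \<longlonglongrightarrow> 1 / (6 * 2 ^ k)"
proof -
  \<comment> \<open>The shift n = i + k + 1 removes the truncated subtractions.\<close>
  have "(\<lambda>i. (mult_seq (Suc i) + mult_seq i - 1) / 2 ^ (i + Suc k)) \<longlonglongrightarrow> 1 / (6 * 2 ^ k)"
  proof -
    \<comment> \<open>The terms of \<open>mult_seq\<close> that are linear in the index cancel
      between consecutive levels, so only geometric errors remain.\<close>
    have eq: "(mult_seq (Suc i) + mult_seq i - 1) / 2 ^ (i + Suc k)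
        = (1 / 6 - 1 / 4 * (1 / 2) ^ i + 1 / 12 * (- 1 / 2) ^ i) / 2 ^ k" for i
      by (simp add: mult_seq_def power_add power_divide power_minus' field_simps)
    have "(\<lambda>i. (1 / 6 - 1 / 4 * (1 / 2) ^ i + 1 / 12 * (- 1 / 2) ^ i) / 2 ^ k)
        \<longlonglongrightarrow> (1 / 6 - 1 / 4 * 0 + 1 / 12 * 0) / (2 ^ k :: real)"
      by (intro tendsto_intros LIMSEQ_power_zero) auto
    then show ?thesis
      unfolding eq by simp
  qed
  then have "(\<lambda>i. (mult_seq (i + Suc k - k) + mult_seq (i + Suc k - 1 - k) - 1) / 2 ^ (i + Suc k))
      \<longlonglongrightarrow> 1 / (6 * 2 ^ k)"
    by simp
  then show ?thesis
    by (rule LIMSEQ_offset)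
qed

text \<open>Only births up to level \<open>K\<close> are counted, so the limits of the finitely many
  lower bounds can be added.\<close>

lemma eventually_\<nu>_mass_gt:
  assumes "c < (\<Sum>j<K. \<mu>_term A j)"
  shows "\<forall>\<^sub>F n in sequentially. c < \<nu>_mass n A"
proof -
  define h where "h n = (\<Sum>j<K. \<Sum>\<theta>\<in>born (j + 1) \<inter> A.
    (mult_seq (n - (j + 1)) + mult_seq (n - 1 - (j + 1)) - 1) / 2 ^ n)" for n
  have "h \<longlonglongrightarrow> (\<Sum>j<K. \<Sum>\<theta>\<in>born (j + 1) \<inter> A. 1 / (6 * 2 ^ (j + 1)))"
    unfolding h_def by (intro tendsto_sum tendsto_eig_mult_bound)
  also have "(\<Sum>j<K. \<Sum>\<theta>\<in>born (j + 1) \<inter> A. 1 / (6 * 2 ^ (j + 1))) = (\<Sum>j<K. \<mu>_term A j)"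
    by (simp add: \<mu>_term_def)
  finally have "\<forall>\<^sub>F n in sequentially. c < h n"
    using assms by (rule order_tendstoD(1))
  moreover have "\<forall>\<^sub>F n in sequentially. h n \<le> \<nu>_mass n A"
    \<comment> \<open>The birth levels j + 1 reach up to \<open>K\<close>, and
      \<open>eig_mult_ge\<close> asks for a birth strictly before n.\<close>
    using eventually_gt_at_top[of K]
  proof eventually_elim
    case (elim n)
    let ?m = "\<lambda>\<theta>. real (eig_mult (\<Gamma> n) \<theta>)"
    let ?F = "\<Union>j<K. born (j + 1) \<inter> A"
    have "h n \<le> (\<Sum>j<K. \<Sum>\<theta>\<in>born (j + 1) \<inter> A. ?m \<theta> / 2 ^ n)"
      unfolding h_def using elim by (intro sum_mono divide_right_mono eig_mult_ge) auto
    also have "\<dots> = (\<Sum>\<theta>\<in>?F. ?m \<theta> / 2 ^ n)"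
    proof (rule sum.UNION_disjoint[symmetric])
      show "\<forall>i\<in>{..<K}. \<forall>j\<in>{..<K}. i \<noteq> j \<longrightarrow> (born (i + 1) \<inter> A) \<inter> (born (j + 1) \<inter> A) = {}"
      proof (intro ballI impI)
        fix i j :: nat
        assume "i \<noteq> j"
        then have "born (i + 1) \<inter> born (j + 1) = {}"
          by (intro born_disjoint) simp
        then show "(born (i + 1) \<inter> A) \<inter> (born (j + 1) \<inter> A) = {}"
          by blast
      qed
    qed simp_all
    also have "\<dots> = (\<Sum>\<theta>\<in>?F \<inter> spectrum (\<Gamma> n). ?m \<theta> / 2 ^ n)"
    proof (rule sum.mono_neutral_right)
      show "\<forall>\<theta>\<in>?F - ?F \<inter> spectrum (\<Gamma> n). ?m \<theta> / 2 ^ n = 0"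
      proof
        fix \<theta> assume "\<theta> \<in> ?F - ?F \<inter> spectrum (\<Gamma> n)"
        then have "\<theta> \<notin> spectrum (\<Gamma> n)"
          by blast
        then show "?m \<theta> / 2 ^ n = 0"
          by (simp add: eig_mult_eq_0)
      qed
    qed auto
    also have "\<dots> \<le> (\<Sum>\<theta>\<in>spectrum (\<Gamma> n) \<inter> A. ?m \<theta> / 2 ^ n)"
      by (rule sum_mono2) (auto simp: finite_spectrum_\<Gamma>)
    also have "\<dots> = \<nu>_mass n A"
      by (simp add: \<nu>_mass_def sum_divide_distrib)
    finally show ?case .
  qed
  ultimately show ?thesis
    by eventually_elim simp
qed

text \<open>A larger partial sum would force some \<open>\<nu> n\<close> to have mass above 1.
  Summability thus follows without any estimate of the numbers of births.\<close>

lemma sum_\<mu>_term_le_1: "(\<Sum>j<K. \<mu>_term A j) \<le> 1"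
proof (rule ccontr)
  assume "\<not> (\<Sum>j<K. \<mu>_term A j) \<le> 1"
  then have "\<forall>\<^sub>F n in sequentially. 1 < \<nu>_mass n A"
    by (intro eventually_\<nu>_mass_gt[of 1 A K]) simp
  then obtain n where "1 < \<nu>_mass n A"
    using eventually_happens'[OF sequentially_bot] by blast
  then show False
    using \<nu>_mass_add_le[of n A] \<nu>_mass_nonneg[of n "- A"] by linarith
qed

lemma \<mu>_term_nonneg: "0 \<le> \<mu>_term A j"
  by (simp add: \<mu>_term_def)

lemma summable_\<mu>_term: "summable (\<mu>_term A)"
  by (rule summableI_nonneg_bounded[OF \<mu>_term_nonneg sum_\<mu>_term_le_1])

lemma measure_\<mu>:
  assumes "A \<in> sets borel"
  shows "measure \<mu> A = suminf (\<mu>_term A)"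
proof -
  have inner: "(\<Sum>\<theta> | poly (\<gamma> (j + 1)) \<theta> = 0. emeasure (return borel \<theta>) A)
      = ennreal (real (card (born (j + 1) \<inter> A)))" for j
  proof -
    have "(\<Sum>\<theta> | poly (\<gamma> (j + 1)) \<theta> = 0. emeasure (return borel \<theta>) A)
        = (\<Sum>\<theta>\<in>born (j + 1). if \<theta> \<in> A then 1 else 0)"
      using assms unfolding roots_\<gamma> by (intro sum.cong) auto
    also have "\<dots> = of_nat (card (born (j + 1) \<inter> A))"
      by (simp add: sum.inter_restrict[symmetric])
    finally show ?thesis
      by (simp add: ennreal_of_nat_eq_real_of_nat)
  qed
  have "emeasure \<mu> A = (\<Sum>j. ennreal (2 / 3) * (ennreal (1 / 2 ^ (j + 3)) * ennreal (real (card (born (j + 1) \<inter> A)))))"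
    unfolding emeasure_\<mu>[OF assms] inner by (rule ennreal_suminf_cmult[symmetric])
  also have "\<dots> = (\<Sum>j. ennreal (\<mu>_term A j))"
  proof (rule suminf_cong)
    fix j
    let ?c = "real (card (born (j + 1) \<inter> A))"
    have "\<mu>_term A j = 2 / 3 * (1 / 2 ^ (j + 3) * ?c)"
      by (simp add: \<mu>_term_def power_add)
    also have "ennreal \<dots> = ennreal (2 / 3) * ennreal (1 / 2 ^ (j + 3) * ?c)"
      by (rule ennreal_mult) simp_all
    also have "ennreal (1 / 2 ^ (j + 3) * ?c) = ennreal (1 / 2 ^ (j + 3)) * ennreal ?c"
      by (rule ennreal_mult) simp_all
    finally show "ennreal (2 / 3) * (ennreal (1 / 2 ^ (j + 3)) * ennreal ?c) = ennreal (\<mu>_term A j)"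
      by (rule sym)
  qed
  also have "\<dots> = ennreal (suminf (\<mu>_term A))"
    by (rule suminf_ennreal2[OF \<mu>_term_nonneg summable_\<mu>_term])
  finally show ?thesis
    unfolding measure_def using suminf_nonneg[OF summable_\<mu>_term \<mu>_term_nonneg] by simp
qed

section \<open>Total mass of the limit\<close>

lemma summable_mult_seq_error: "summable (\<lambda>j. \<bar>mult_seq j / 2 ^ j - 1 / 9\<bar>)"
proof (rule summable_comparison_test')
  \<comment> \<open>The error is a term linear in j times 2^-j, so it is dominated by the
    differentiated geometric series.\<close>
  show "summable (\<lambda>j. of_nat (Suc j) * (1 / 2 :: real) ^ j)"
    using geometric_deriv_sums[of "1 / 2 :: real"] by (simp add: sums_iff)
  fix j :: nat
  define z where "z = (9 + (23 - 6 * real j) * (- 1) ^ j) / 36"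
  have "mult_seq j / 2 ^ j - 1 / 9 = z * (1 / 2) ^ j"
    by (simp add: mult_seq_def z_def field_simps power_divide)
  then have "norm \<bar>mult_seq j / 2 ^ j - 1 / 9\<bar> = \<bar>z\<bar> * (1 / 2) ^ j"
    by (simp add: abs_mult)
  also have "\<bar>z\<bar> \<le> real (Suc j)"
    unfolding z_def by (cases "even j") auto
  finally show "norm \<bar>mult_seq j / 2 ^ j - 1 / 9\<bar> \<le> of_nat (Suc j) * (1 / 2) ^ j"
    by simp
qed

text \<open>The total mass of the limit is computed by comparing the number of inner vertices of \<open>G n\<close>,
  asymptotically \<open>2 / 3 * 2 ^ n\<close>, with the number of Dirichlet eigenvalues counted by birth level.\<close>

lemma suminf_\<mu>_term_UNIV: "suminf (\<mu>_term UNIV) = 1"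
proof -
  define g where "g k = real (card (born k)) / 2 ^ k" for k
  define \<tau> where "\<tau> j = mult_seq j / 2 ^ j - 1 / 9" for j
  have g_Suc: "g (Suc j) = 6 * \<mu>_term UNIV j" for j
    by (simp add: g_def \<mu>_term_def)
  have g_nonneg: "0 \<le> g k" for k
    by (simp add: g_def)
  have "summable (\<lambda>j. g (Suc j))"
    unfolding g_Suc by (intro summable_mult summable_\<mu>_term)
  then have sg: "summable g"
    by (simp only: summable_Suc_iff)
  have "suminf g = g 0 + (\<Sum>j. g (Suc j))"
    using suminf_split_head[OF sg] by simp
  then have g_total: "suminf g = 6 * suminf (\<mu>_term UNIV)"
    unfolding g_Suc suminf_mult[OF summable_\<mu>_term] by (simp add: g_def born_0)
  \<comment> \<open>Splitting \<open>mult_seq j / 2 ^ j\<close> as 1/9 plus \<tau> turns the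
    normalized count into a ninth of a partial sum of \<open>g\<close> plus a convolution. The
    latter is the general term of a convergent Cauchy product, hence tends to 0: the errors at all
    birth levels are controlled at once.\<close>
  have "summable (\<lambda>n. \<Sum>k\<le>n. g k * \<tau> (n - k))"
    using sg summable_mult_seq_error g_nonneg by (intro summable_Cauchy_product) (simp_all add: \<tau>_def)
  then have "(\<lambda>n. \<Sum>k\<le>n. g k * \<tau> (n - k)) \<longlonglongrightarrow> 0"
    by (rule summable_LIMSEQ_zero)
  moreover have "(\<lambda>n. \<Sum>k\<le>n. g k) \<longlonglongrightarrow> suminf g"
    by (rule summable_LIMSEQ'[OF sg])
  ultimately have "(\<lambda>n. (\<Sum>k\<le>n. g k) / 9 + (\<Sum>k\<le>n. g k * \<tau> (n - k))) \<longlonglongrightarrow> suminf g / 9 + 0"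
    by (intro tendsto_intros) auto
  moreover have "(\<lambda>n. 2 / 3 - 2 / 3 * (1 / 2) ^ n) \<longlonglongrightarrow> 2 / 3 - 2 / 3 * (0 :: real)"
    by (intro tendsto_intros LIMSEQ_power_zero) auto
  moreover have "2 / 3 - 2 / 3 * (1 / 2) ^ n \<le> (\<Sum>k\<le>n. g k) / 9 + (\<Sum>k\<le>n. g k * \<tau> (n - k))" for n
  proof -
    have "2 / 3 - 2 / 3 * (1 / 2) ^ n = (4 * 2 ^ n - 4) / 6 / (2 ^ n :: real)"
      by (simp add: field_simps power_divide)
    also have "\<dots> \<le> (\<Sum>k\<le>n. real (card (born k)) * mult_seq (n - k)) / 2 ^ n"
      by (intro divide_right_mono order_trans[OF card_inside_ge card_inside_le]) simp
    also have "\<dots> = (\<Sum>k\<le>n. g k * (1 / 9 + \<tau> (n - k)))"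
      unfolding sum_divide_distrib
    proof (intro sum.cong refl)
      fix k assume "k \<in> {..n}"
      then have "(2 :: real) ^ n = 2 ^ k * 2 ^ (n - k)"
        by (simp add: power_add[symmetric])
      then show "real (card (born k)) * mult_seq (n - k) / 2 ^ n = g k * (1 / 9 + \<tau> (n - k))"
        by (simp add: g_def \<tau>_def)
    qed
    also have "\<dots> = (\<Sum>k\<le>n. g k) / 9 + (\<Sum>k\<le>n. g k * \<tau> (n - k))"
      by (simp add: distrib_left sum.distrib sum_divide_distrib)
    finally show ?thesis .
  qed
  ultimately have "2 / 3 - 2 / 3 * 0 \<le> suminf g / 9 + 0"
    by (intro LIMSEQ_le[of _ "2 / 3 - 2 / 3 * 0" _ "suminf g / 9 + 0"]) auto
  then have "1 \<le> suminf (\<mu>_term UNIV)"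
    using g_total by simp
  moreover have "suminf (\<mu>_term UNIV) \<le> 1"
    by (rule suminf_le_const[OF summable_\<mu>_term sum_\<mu>_term_le_1])
  ultimately show ?thesis
    by simp
qed

lemma suminf_\<mu>_term_add: "suminf (\<mu>_term A) + suminf (\<mu>_term (- A)) = 1"
proof -
  have "\<mu>_term A j + \<mu>_term (- A) j = \<mu>_term UNIV j" for j
  proof -
    have "card (born (j + 1) \<inter> A) + card (born (j + 1) \<inter> - A) = card (born (j + 1))"
      using card_Int_Diff[OF finite_born, of "j + 1" A] by (simp add: Diff_eq)
    then have "real (card (born (j + 1) \<inter> A)) + real (card (born (j + 1) \<inter> - A)) = real (card (born (j + 1)))"
      by (metis of_nat_add)
    then show ?thesis
      unfolding \<mu>_term_def add_divide_distrib[symmetric] by simp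
  qed
  then show ?thesis
    using suminf_add[OF summable_\<mu>_term summable_\<mu>_term, of A "- A"] suminf_\<mu>_term_UNIV by simp
qed

text \<open>Both masses of \<open>A\<close> and of its complement are bounded below in the limit; since the limit has
  full mass, neither bound can be strict.\<close>

lemma \<nu>_mass_tendsto: "(\<lambda>n. \<nu>_mass n A) \<longlonglongrightarrow> suminf (\<mu>_term A)"
proof (rule order_tendstoI)
  have lower: "\<forall>\<^sub>F n in sequentially. c < \<nu>_mass n B" if c: "c < suminf (\<mu>_term B)" for c B
  proof -
    obtain K where "c < (\<Sum>j<K. \<mu>_term B j)"
      using order_tendstoD(1)[OF summable_LIMSEQ[OF summable_\<mu>_term] c]
        eventually_happens'[OF sequentially_bot] by blast
    then show ?thesis
      by (rule eventually_\<nu>_mass_gt)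
  qed
  show "\<forall>\<^sub>F n in sequentially. c < \<nu>_mass n A" if "c < suminf (\<mu>_term A)" for c
    using that by (rule lower)
  show "\<forall>\<^sub>F n in sequentially. \<nu>_mass n A < c" if "suminf (\<mu>_term A) < c" for c
  proof -
    have "\<forall>\<^sub>F n in sequentially. 1 - c < \<nu>_mass n (- A)"
      using that suminf_\<mu>_term_add[of A] by (intro lower) simp
    then show ?thesis
    proof eventually_elim
      case (elim n)
      then show ?case
        using \<nu>_mass_add_le[of n A] by linarith
    qed
  qed
qed

text \<open>The masses of every Borel set converge, in particular those of all half-lines, so the
  distribution functions converge at every point and not merely where the limit is
  continuous.\<close>

theorem theorem5p7:
  shows "weak_conv_m \<nu> \<mu>"
  unfolding weak_conv_m_def weak_conv_def cdf_def
  using \<nu>_mass_tendsto by (simp add: measure_\<nu> measure_\<mu>)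

end
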